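(* There is a $5$-dimensional spindle, with $48$ facets and $322$ vertices, of length six.
   Context: Polytopes are convex and bounded. A $d$-spindle is a $d$-dimensional polytope $P$ with two distinguished vertices $u$ and $v$ such that every facet of $P$ contains exactly one of them. The length of a spindle is the distance between $u$ and $v$ in the graph of $P$ (the graph formed by the vertices and edges of $P$). *)

theory Defs
  imports "HOL-Analysis.Analysis" "HOL-Library.Extended_Nat"
begin

definition polytope_graph :: "'a::euclidean_space set \<Rightarrow> ('a \<times> 'a) set" where
  "polytope_graph P =
     {(x, y). x extreme_point_of P \<and> y extreme_point_of P \<and> closed_segment x y edge_of P}"

text \<open>The infimum is taken in \<^typ>\<open>enat\<close>, so that points not joined by any
  walk have distance \<open>\<infinity>\<close>.\<close>

definition graph_dist :: "('a \<times> 'a) set \<Rightarrow> 'a \<Rightarrow> 'a \<Rightarrow> enat" where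
  "graph_dist E x y = (INF n\<in>{n. (x, y) \<in> E ^^ n}. enat n)"

definition spindle :: "nat \<Rightarrow> 'a::euclidean_space set \<Rightarrow> 'a \<Rightarrow> 'a \<Rightarrow> bool" where
  "spindle d P u v \<longleftrightarrow>
     polytope P \<and> aff_dim P = int d \<and>
     u extreme_point_of P \<and> v extreme_point_of P \<and> u \<noteq> v \<and>
     (\<forall>F. F facet_of P \<longrightarrow> (u \<in> F \<and> v \<notin> F) \<or> (u \<notin> F \<and> v \<in> F))"

definition spindle_length :: "'a::euclidean_space set \<Rightarrow> 'a \<Rightarrow> 'a \<Rightarrow> enat" where
  "spindle_length P u v = graph_dist (polytope_graph P) u v"

end

theory Submission
  imports Defs
begin

text \<open>The polytope is Santos' spindle, given by 48 facet inequalities that are permuted by a group of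
  order 64, generated by the sign changes of the first four coordinates and a map \<open>rot\<close> that exchanges
  the two apices. The 320 further vertices form five orbits of this group. At each of them the polytope
  lies in the cone spanned by five or six edges to explicit neighbours, which for one representative of
  each orbit is an identity expressing a functional through facet slacks. These cones alone give the
  vertex enumeration and locate all edges: heights of adjacent vertices belong to neighbouring ones
  among seven levels, and the apices are on the first and the last level, so that every path between
  them has at least six edges. A path of six edges is exhibited.\<close>

section \<open>Vectors with five coordinates\<close>

text \<open>The cone at \<open>w\<close> enters in dual form: a functional that is maximal at
  \<open>w\<close> among the points of \<open>N\<close> is maximal at \<open>w\<close> on all of
  \<open>P\<close>, as in the stopping rule of the simplex method. For the enumeration, a point of
  \<open>P\<close> outside the hull of \<open>S\<close> would give a functional whose maximum over
  \<open>S\<close> is not its maximum over \<open>P\<close>. For the edges, a functional exposing an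
  edge from \<open>w\<close> to a vertex outside \<open>N\<close> could be tilted into one that is
  maximal at \<open>w\<close> on \<open>N\<close> but not on \<open>P\<close>.

  The obstacle is the two apices. Each lies on 24 facets, so their cones are far from simplicial and
  are avoided: the separating functional is tilted until its maximum over \<open>S\<close> is
  attained elsewhere, and an edge needs a cone at only one of its ends, which leaves just the
  segment between the apices.

  Height alone is no measure of distance: a vertex at height -3780 has listed neighbours at heights
  6300 and -6300, so only one level fits between these two.\<close>

lemma exhaust_5:
  fixes x :: 5
  shows "x = 1 \<or> x = 2 \<or> x = 3 \<or> x = 4 \<or> x = 5"
proof (induct x)
  case (of_int z)
  then have "z = 0 \<or> z = 1 \<or> z = 2 \<or> z = 3 \<or> z = 4" by fastforce
  then show ?case by auto
qed

lemma forall_5: "(\<forall>i::5. Q i) \<longleftrightarrow> Q 1 \<and> Q 2 \<and> Q 3 \<and> Q 4 \<and> Q 5"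
  by (metis exhaust_5)

lemma UNIV_5: "UNIV = {1, 2, 3, 4, 5::5}"
  using exhaust_5 by auto

lemma sum_5: "sum f (UNIV::5 set) = f 1 + f 2 + f 3 + f 4 + f 5"
  unfolding UNIV_5 by (simp add: ac_simps)

definition V :: "real \<Rightarrow> real \<Rightarrow> real \<Rightarrow> real \<Rightarrow> real \<Rightarrow> real ^ 5" where
  "V a b c d e = (\<chi> i. if i = 1 then a else if i = 2 then b else if i = 3 then c
                      else if i = 4 then d else e)"

lemma V_nth [simp]:
  "V a b c d e $ 1 = a" "V a b c d e $ 2 = b" "V a b c d e $ 3 = c"
  "V a b c d e $ 4 = d" "V a b c d e $ 5 = e"
  by (simp_all add: V_def)

lemma V_eta: "V (x $ 1) (x $ 2) (x $ 3) (x $ 4) (x $ 5) = x"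
  by (simp add: vec_eq_iff forall_5)

lemma V_cases:
  obtains a b c d e where "x = V a b c d e"
  by (metis V_eta)

lemma V_eq_iff [simp]:
  "V a b c d e = V a' b' c' d' e' \<longleftrightarrow> a = a' \<and> b = b' \<and> c = c' \<and> d = d' \<and> e = e'"
  by (auto simp: vec_eq_iff forall_5)

lemma inner_V [simp]:
  "V a b c d e \<bullet> V a' b' c' d' e' = a * a' + b * b' + c * c' + d * d' + e * e'"
  by (simp add: inner_vec_def sum_5)

lemma V_linear [simp]:
  "V a b c d e + V a' b' c' d' e' = V (a + a') (b + b') (c + c') (d + d') (e + e')"
  "V a b c d e - V a' b' c' d' e' = V (a - a') (b - b') (c - c') (d - d') (e - e')"
  "r *\<^sub>R V a b c d e = V (r * a) (r * b) (r * c) (r * d) (r * e)"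
  "- V a b c d e = V (- a) (- b) (- c) (- d) (- e)"
  by (simp_all add: vec_eq_iff forall_5)

lemma zero_V: "0 = V 0 0 0 0 0"
  by (simp add: vec_eq_iff forall_5)

section \<open>The polytope, its symmetries and its vertices\<close>

text \<open>The inequalities from \<open>L\<close> are tight at \<open>apex\<close>; the others are
  their images under \<open>rot\<close> and tight at \<open>- apex\<close>. Thus \<open>P\<close> is
  the intersection of two opposite cones. A list of integer tuples lets the facets be checked by
  evaluation.\<close>

definition facet_normals :: "(int \<times> int \<times> int \<times> int \<times> int) list" where
  "facet_normals =
    (let sg = [1, -1];
         L = [(18 * s, 0, 0, 0, 1). s \<leftarrow> sg] @ [(0, 18 * s, 0, 0, 1). s \<leftarrow> sg] @
             [(0, 0, 45 * s, 0, 1). s \<leftarrow> sg] @ [(0, 0, 0, 45 * s, 1). s \<leftarrow> sg] @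
             [(15 * s, 15 * t, 0, 0, 1). s \<leftarrow> sg, t \<leftarrow> sg] @
             [(0, 0, 30 * s, 30 * t, 1). s \<leftarrow> sg, t \<leftarrow> sg] @
             [(0, 10 * s, 40 * t, 0, 1). s \<leftarrow> sg, t \<leftarrow> sg] @
             [(10 * s, 0, 0, 40 * t, 1). s \<leftarrow> sg, t \<leftarrow> sg]
     in L @ map (\<lambda>(a, b, c, d, e). (c, d, b, a, - e)) L)"

fun ivec :: "int \<times> int \<times> int \<times> int \<times> int \<Rightarrow> real ^ 5" where
  "ivec (a, b, c, d, e) = V (of_int a) (of_int b) (of_int c) (of_int d) (of_int e)"

text \<open>The polytope is scaled by 18900, the least factor that makes all vertices integral.\<close>

definition P :: "(real ^ 5) set" where
  "P = {x. \<forall>a \<in> set facet_normals. ivec a \<bullet> x \<le> 18900}"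

lemma V_in_P:
  "V a b c d e \<in> P \<longleftrightarrow> (\<forall>n \<in> set facet_normals. ivec n \<bullet> V a b c d e \<le> 18900)"
  by (simp add: P_def)

lemma facet_ineq:
  "V x1 x2 x3 x4 x5 \<in> P \<Longrightarrow> (a, b, c, d, e) \<in> set facet_normals \<Longrightarrow>
    0 \<le> 18900 - (of_int a * x1 + of_int b * x2 + of_int c * x3 + of_int d * x4 + of_int e * x5)"
  by (fastforce simp: V_in_P)

lemmas V_in_P_linear = V_in_P [unfolded facet_normals_def Let_def, simplified]

lemma abs_add_le_iff:
  fixes x y :: real
  assumes "k \<ge> 0" "l \<ge> 0"
  shows "k * \<bar>x\<bar> + l * \<bar>y\<bar> + z \<le> w \<longleftrightarrow>
    k * x + l * y + z \<le> w \<and> - (k * x) + l * y + z \<le> w \<and>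
    k * x - l * y + z \<le> w \<and> - (k * x) - l * y + z \<le> w"
proof -
  have "k * \<bar>x\<bar> = \<bar>k * x\<bar>" "l * \<bar>y\<bar> = \<bar>l * y\<bar>"
    using assms by (simp_all add: abs_mult)
  then show ?thesis by (simp only:) linarith
qed

text \<open>Each orbit of inequalities under sign changes is condensed into one, 16 in place of 48,
  which makes invariance under \<open>flip\<close> and \<open>unrot\<close> a matter of
  rewriting.\<close>

lemma V_in_P_abs:
  "V a b c d e \<in> P \<longleftrightarrow>
    18 * \<bar>a\<bar> + e \<le> 18900 \<and> 18 * \<bar>b\<bar> + e \<le> 18900 \<and> 45 * \<bar>c\<bar> + e \<le> 18900 \<and> 45 * \<bar>d\<bar> + e \<le> 18900 \<and>
    15 * \<bar>a\<bar> + 15 * \<bar>b\<bar> + e \<le> 18900 \<and> 30 * \<bar>c\<bar> + 30 * \<bar>d\<bar> + e \<le> 18900 \<and>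
    10 * \<bar>b\<bar> + 40 * \<bar>c\<bar> + e \<le> 18900 \<and> 10 * \<bar>a\<bar> + 40 * \<bar>d\<bar> + e \<le> 18900 \<and>
    18 * \<bar>c\<bar> - e \<le> 18900 \<and> 18 * \<bar>d\<bar> - e \<le> 18900 \<and> 45 * \<bar>b\<bar> - e \<le> 18900 \<and> 45 * \<bar>a\<bar> - e \<le> 18900 \<and>
    15 * \<bar>c\<bar> + 15 * \<bar>d\<bar> - e \<le> 18900 \<and> 30 * \<bar>b\<bar> + 30 * \<bar>a\<bar> - e \<le> 18900 \<and>
    10 * \<bar>d\<bar> + 40 * \<bar>b\<bar> - e \<le> 18900 \<and> 10 * \<bar>c\<bar> + 40 * \<bar>a\<bar> - e \<le> 18900"
proof -
  have 1: "k * \<bar>x\<bar> + z \<le> w \<longleftrightarrow> k * x + z \<le> w \<and> - (k * x) + z \<le> w" if "k \<ge> 0" for k x z w :: real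
    using abs_add_le_iff [of k 0 x 0 z w] that by auto
  \<comment> \<open>Turns \<open>- e\<close> into a summand, so that it can match \<open>z\<close>
    in \<open>abs_add_le_iff\<close>.\<close>
  have e: "x - e = x + - e" for x by simp
  show ?thesis
    unfolding V_in_P_linear e
    by (simp only: abs_add_le_iff 1 zero_le_numeral, simp add: algebra_simps,
        (intro iffI conjI; elim conjE; assumption))
qed

definition apex :: "real ^ 5" where "apex = V 0 0 0 0 18900"

text \<open>The vertices other than the two apices, up to the signs of the first four coordinates; any two
  consecutive lines form an orbit of \<open>rot\<close>.\<close>

definition abs_vertices :: "(real \<times> real \<times> real \<times> real \<times> real) set" where
  "abs_vertices =
    {(120, 600, 120, 240, 8100), (120, 240, 600, 120, - 8100),
     (600, 120, 240, 120, 8100), (240, 120, 120, 600, - 8100),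
     (140, 560, 140, 280, 6300), (140, 280, 560, 140, - 6300),
     (560, 140, 280, 140, 6300), (280, 140, 140, 560, - 6300),
     (280, 560, 175, 245, 6300), (175, 245, 560, 280, - 6300),
     (560, 280, 245, 175, 6300), (245, 175, 280, 560, - 6300),
     (252, 252, 252, 504, - 3780), (252, 504, 252, 252, 3780),
     (252, 252, 504, 252, - 3780), (504, 252, 252, 252, 3780),
     (270, 540, 180, 270, 5400), (180, 270, 540, 270, - 5400),
     (540, 270, 270, 180, 5400), (270, 180, 270, 540, - 5400)}"

abbreviation signs :: "real set" where "signs \<equiv> {1, - 1}"

fun flip :: "real \<times> real \<times> real \<times> real \<Rightarrow> real ^ 5 \<Rightarrow> real ^ 5" where
  "flip (p, q, r, s) x = V (p * x $ 1) (q * x $ 2) (r * x $ 3) (s * x $ 4) (x $ 5)"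

definition rot :: "real ^ 5 \<Rightarrow> real ^ 5" where
  "rot x = V (x $ 3) (x $ 4) (x $ 2) (x $ 1) (- x $ 5)"

text \<open>The inverse of \<open>rot\<close>, and also its adjoint since \<open>rot\<close> is
  orthogonal; functionals are pulled back along it.\<close>

definition unrot :: "real ^ 5 \<Rightarrow> real ^ 5" where
  "unrot x = V (x $ 4) (x $ 3) (x $ 1) (x $ 2) (- x $ 5)"

abbreviation sign_vectors :: "(real \<times> real \<times> real \<times> real) set" where
  "sign_vectors \<equiv> signs \<times> signs \<times> signs \<times> signs"

fun vertex :: "(real \<times> real \<times> real \<times> real) \<times> (real \<times> real \<times> real \<times> real \<times> real) \<Rightarrow> real ^ 5" where
  "vertex ((p, q, r, s), (a, b, c, d, e)) = V (p * a) (q * b) (r * c) (s * d) e"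

definition T :: "(real ^ 5) set" where
  "T = vertex ` (sign_vectors \<times> abs_vertices)"

definition S :: "(real ^ 5) set" where
  "S = {apex, - apex} \<union> T"

lemma abs_vertices_pos:
  "(a, b, c, d, e) \<in> abs_vertices \<Longrightarrow> a > 0 \<and> b > 0 \<and> c > 0 \<and> d > 0"
  unfolding abs_vertices_def by (elim insertE emptyE) simp_all

text \<open>The first four coordinates of a point of \<open>T\<close> are never zero, so their signs
  and absolute values determine each other's role uniquely. This reduces membership to a lookup
  among twenty tuples.\<close>

lemma V_in_T: "V a b c d e \<in> T \<longleftrightarrow> (\<bar>a\<bar>, \<bar>b\<bar>, \<bar>c\<bar>, \<bar>d\<bar>, e) \<in> abs_vertices"
proof
  assume "V a b c d e \<in> T"
  then obtain g t where "V a b c d e = vertex (g, t)" "g \<in> sign_vectors" "t \<in> abs_vertices"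
    unfolding T_def by blast
  moreover obtain p q r s where "g = (p, q, r, s)" by (rule prod_cases4)
  moreover obtain a' b' c' d' e' where "t = (a', b', c', d', e')" by (rule prod_cases5)
  ultimately have
    "(p, q, r, s) \<in> sign_vectors" "(a', b', c', d', e) \<in> abs_vertices"
    "a = p * a'" "b = q * b'" "c = r * c'" "d = s * d'"
    by simp_all
  moreover from this have "\<bar>a\<bar> = a'" "\<bar>b\<bar> = b'" "\<bar>c\<bar> = c'" "\<bar>d\<bar> = d'"
    using abs_vertices_pos [of a' b' c' d' e] by (auto simp: abs_mult)
  ultimately show "(\<bar>a\<bar>, \<bar>b\<bar>, \<bar>c\<bar>, \<bar>d\<bar>, e) \<in> abs_vertices"
    by simp
next
  assume *: "(\<bar>a\<bar>, \<bar>b\<bar>, \<bar>c\<bar>, \<bar>d\<bar>, e) \<in> abs_vertices"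
  then have "a \<noteq> 0" "b \<noteq> 0" "c \<noteq> 0" "d \<noteq> 0"
    using abs_vertices_pos by fastforce+
  then have "(sgn a, sgn b, sgn c, sgn d) \<in> sign_vectors"
    by (simp add: sgn_if)
  moreover have "V a b c d e = vertex ((sgn a, sgn b, sgn c, sgn d), (\<bar>a\<bar>, \<bar>b\<bar>, \<bar>c\<bar>, \<bar>d\<bar>, e))"
    by (simp add: sgn_mult_abs)
  ultimately show "V a b c d e \<in> T"
    unfolding T_def using * by (intro image_eqI) (assumption, blast)
qed

lemma finite_abs_vertices: "finite abs_vertices"
  by (simp add: abs_vertices_def)

lemma card_abs_vertices: "card abs_vertices = 20"
  by (simp add: abs_vertices_def)

lemma finite_T: "finite T"
  unfolding T_def by (intro finite_imageI finite_cartesian_product finite_abs_vertices) simp_all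

lemma finite_S: "finite S" by (simp add: S_def finite_T)

lemma card_T: "card T = 320"
proof -
  have eq: "p = q \<and> x = y" if "p * x = q * y" "p \<in> signs" "q \<in> signs" "x > 0" "y > 0" for p q x y :: real
    using that by auto
  have "inj_on vertex (sign_vectors \<times> abs_vertices)"
  proof (rule inj_onI, clarify, goal_cases)
    case prems: (1 p q r s a b c d e p' q' r' s' a' b' c' d' e')
    from prems(1) have "p * a = p' * a'" "q * b = q' * b'" "r * c = r' * c'" "s * d = s' * d'" "e = e'"
      by simp_all
    with prems(2-) abs_vertices_pos [of a b c d e] abs_vertices_pos [of a' b' c' d' e']
    have "p = p' \<and> a = a'" "q = q' \<and> b = b'" "r = r' \<and> c = c'" "s = s' \<and> d = d'"
      by (intro eq; simp)+
    with \<open>e = e'\<close> show ?case by simp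
  qed
  then have "card T = card (sign_vectors \<times> abs_vertices)"
    unfolding T_def by (rule card_image)
  also have "\<dots> = 320"
    by (simp add: card_cartesian_product card_abs_vertices)
  finally show ?thesis .
qed

lemma apex_notin_T: "apex \<notin> T" "- apex \<notin> T"
  by (simp_all add: apex_def V_in_T abs_vertices_def)

lemma card_S: "card S = 322"
  using card_T finite_T apex_notin_T by (simp add: S_def apex_def)

section \<open>Invariance of the polytope and of the vertex set under the symmetries\<close>

lemma sign_vectors_cases:
  assumes "g \<in> sign_vectors"
  obtains p q r s where "g = (p, q, r, s)" "\<bar>p\<bar> = 1" "\<bar>q\<bar> = 1" "\<bar>r\<bar> = 1" "\<bar>s\<bar> = 1"
  using assms by (cases g) auto

lemma flip_in_P: "x \<in> P \<Longrightarrow> g \<in> sign_vectors \<Longrightarrow> flip g x \<in> P"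
  by (cases x rule: V_cases, cases g rule: sign_vectors_cases) (simp_all add: V_in_P_abs abs_mult)

lemma unrot_in_P: "x \<in> P \<Longrightarrow> unrot x \<in> P"
  by (cases x rule: V_cases) (simp add: unrot_def V_in_P_abs algebra_simps)

lemma flip_in_T: "x \<in> T \<Longrightarrow> g \<in> sign_vectors \<Longrightarrow> flip g x \<in> T"
  by (cases x rule: V_cases, cases g rule: sign_vectors_cases) (simp_all add: V_in_T abs_mult)

lemma abs_vertices_rot: "(a, b, c, d, e) \<in> abs_vertices \<Longrightarrow> (c, d, b, a, - e) \<in> abs_vertices"
  unfolding abs_vertices_def by (elim insertE emptyE) simp_all

lemma rot_in_T: "x \<in> T \<Longrightarrow> rot x \<in> T"
  by (cases x rule: V_cases) (simp add: rot_def V_in_T abs_vertices_rot)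

lemma flip_in_S: "x \<in> S \<Longrightarrow> g \<in> sign_vectors \<Longrightarrow> flip g x \<in> S"
proof -
  assume "x \<in> S" and g: "g \<in> sign_vectors"
  then consider "x = apex" | "x = - apex" | "x \<in> T" by (auto simp: S_def)
  then show "flip g x \<in> S"
    using flip_in_T [OF _ g] by cases (cases g; simp add: S_def apex_def)+
qed

lemma rot_in_S: "x \<in> S \<Longrightarrow> rot x \<in> S"
  using rot_in_T by (auto simp: S_def apex_def rot_def)

lemma abs_vertices_in_P: "(a, b, c, d, e) \<in> abs_vertices \<Longrightarrow> V a b c d e \<in> P"
  unfolding abs_vertices_def by (elim insertE emptyE) (simp_all add: V_in_P_abs)

lemma T_subset_P: "T \<subseteq> P"
proof
  fix x assume "x \<in> T"
  moreover obtain a b c d e where "x = V a b c d e" by (rule V_cases)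
  ultimately show "x \<in> P"
    using abs_vertices_in_P [of "\<bar>a\<bar>" "\<bar>b\<bar>" "\<bar>c\<bar>" "\<bar>d\<bar>" e] by (simp add: V_in_T V_in_P_abs)
qed

lemma apex_in_P: "apex \<in> P" "- apex \<in> P"
  by (simp_all add: apex_def V_in_P_abs)

lemma S_subset_P: "S \<subseteq> P"
  using T_subset_P apex_in_P by (simp add: S_def)

text \<open>The height of the vertices bounds their distance from \<^const>\<open>apex\<close> from below.\<close>

definition level :: "real \<Rightarrow> int" where
  "level t = (if t > 10000 then 0 else if t > 7000 then 1 else if t > 6000 then 2
     else if t \<ge> - 6000 then 3 else if t \<ge> - 7000 then 4 else if t \<ge> - 10000 then 5 else 6)"

lemma level_minus: "level (- t) = 6 - level t"
  by (simp add: level_def)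

lemma level_values [simp]:
  "level 18900 = 0" "level 8100 = 1" "level 6300 = 2" "level 5400 = 3" "level 3780 = 3"
  "level (- 18900) = 6" "level (- 8100) = 5" "level (- 6300) = 4" "level (- 5400) = 3"
  "level (- 3780) = 3"
  by (simp_all add: level_def)

text \<open>The first conjunct makes \<^term>\<open>w\<close> a vertex; the second is the dual form of the statement that
  \<^const>\<open>P\<close> lies in the cone with apex \<^term>\<open>w\<close> spanned by \<^term>\<open>N\<close>.\<close>

definition spanned :: "real ^ 5 \<Rightarrow> bool" where
  "spanned w \<longleftrightarrow>
    (\<exists>k. \<forall>x \<in> P. k \<bullet> w \<le> k \<bullet> x \<longrightarrow> x = w) \<and>
    (\<exists>N \<subseteq> S. (\<forall>n \<in> N. \<bar>level (w $ 5) - level (n $ 5)\<bar> \<le> 1) \<and>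
      (\<forall>c. (\<forall>n \<in> N. c \<bullet> n \<le> c \<bullet> w) \<longrightarrow> (\<forall>x \<in> P. c \<bullet> x \<le> c \<bullet> w)))"

text \<open>A functional \<open>c\<close> at \<open>g w\<close> is pulled back to \<open>h c\<close>
  at \<open>w\<close> along the adjoint \<open>h\<close>, which is also the inverse. The hypothesis
  on levels concerns differences only, because \<open>rot\<close> reverses the order of the
  levels.\<close>

lemma spanned_image:
  assumes w: "spanned w"
    and adj: "\<And>x y. x \<bullet> g y = h x \<bullet> y" and gh: "\<And>x. g (h x) = x" and hg: "\<And>x. h (g x) = x"
    and P: "\<And>x. x \<in> P \<Longrightarrow> h x \<in> P" and S: "\<And>x. x \<in> S \<Longrightarrow> g x \<in> S"
    and level: "\<And>x y. \<bar>level (g x $ 5) - level (g y $ 5)\<bar> = \<bar>level (x $ 5) - level (y $ 5)\<bar>"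
  shows "spanned (g w)"
proof -
  obtain k where k: "\<And>x. x \<in> P \<Longrightarrow> k \<bullet> w \<le> k \<bullet> x \<Longrightarrow> x = w"
    using w unfolding spanned_def by blast
  obtain N where N: "N \<subseteq> S" "\<forall>n \<in> N. \<bar>level (w $ 5) - level (n $ 5)\<bar> \<le> 1"
    "\<forall>c. (\<forall>n \<in> N. c \<bullet> n \<le> c \<bullet> w) \<longrightarrow> (\<forall>x \<in> P. c \<bullet> x \<le> c \<bullet> w)"
    using w unfolding spanned_def by (elim conjE exE) (rule that)
  have "\<forall>x \<in> P. g k \<bullet> g w \<le> g k \<bullet> x \<longrightarrow> x = g w"
  proof (intro ballI impI)
    fix x assume "x \<in> P" "g k \<bullet> g w \<le> g k \<bullet> x"
    then have "k \<bullet> w \<le> k \<bullet> h x"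
      by (simp add: adj hg) (metis adj inner_commute)
    then have "h x = w"
      using \<open>x \<in> P\<close> by (intro k P)
    then show "x = g w" by (metis gh)
  qed
  moreover have "\<forall>c. (\<forall>n \<in> g ` N. c \<bullet> n \<le> c \<bullet> g w) \<longrightarrow> (\<forall>x \<in> P. c \<bullet> x \<le> c \<bullet> g w)"
  proof (intro allI impI ballI)
    fix c x assume c: "\<forall>n \<in> g ` N. c \<bullet> n \<le> c \<bullet> g w" and "x \<in> P"
    then have "\<forall>n \<in> N. h c \<bullet> n \<le> h c \<bullet> w" "h x \<in> P"
      by (simp_all add: adj P)
    then have "h c \<bullet> h x \<le> h c \<bullet> w"
      using N(3) by blast
    moreover have "h c \<bullet> h x = c \<bullet> x" by (metis adj gh)
    ultimately show "c \<bullet> x \<le> c \<bullet> g w" by (simp add: adj)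
  qed
  moreover have "g ` N \<subseteq> S" "\<forall>n \<in> g ` N. \<bar>level (g w $ 5) - level (n $ 5)\<bar> \<le> 1"
    using N(1,2) S by (auto simp: level)
  ultimately show ?thesis
    unfolding spanned_def by blast
qed

lemma spanned_flip:
  assumes "spanned w" "g \<in> sign_vectors"
  shows "spanned (flip g w)"
proof (rule spanned_image [OF assms(1), where h = "flip g"])
  show "x \<bullet> flip g y = flip g x \<bullet> y" for x y
    by (cases x rule: V_cases; cases y rule: V_cases; cases g) (simp add: algebra_simps)
  show "flip g (flip g x) = x" for x
    using assms(2) by (cases x rule: V_cases) auto
  then show "flip g (flip g x) = x" for x .
  show "\<bar>level (flip g x $ 5) - level (flip g y $ 5)\<bar> = \<bar>level (x $ 5) - level (y $ 5)\<bar>" for x y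
    by (cases g) simp
qed (use assms(2) flip_in_P flip_in_S in auto)

lemma spanned_rot:
  assumes "spanned w"
  shows "spanned (rot w)"
proof (rule spanned_image [OF assms, where h = unrot])
  show "x \<bullet> rot y = unrot x \<bullet> y" for x y
    by (cases x rule: V_cases; cases y rule: V_cases) (simp add: rot_def unrot_def)
  show "rot (unrot x) = x" for x
    by (cases x rule: V_cases) (simp add: rot_def unrot_def)
  show "unrot (rot x) = x" for x
    by (cases x rule: V_cases) (simp add: rot_def unrot_def)
qed (simp_all add: unrot_in_P rot_in_S, simp add: rot_def level_minus)

text \<open>In each application \<open>V p q r s t\<close> is the sum of the normals of the facets
  through the vertex. A point of \<open>P\<close> on which it is at least as large as at the vertex
  has vanishing slack on all of them, hence is the vertex.\<close>

lemma spannedI: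
  assumes "N \<subseteq> S" "\<forall>n \<in> N. \<bar>level e - level (n $ 5)\<bar> \<le> 1"
    and k: "\<And>x1 x2 x3 x4 x5. V x1 x2 x3 x4 x5 \<in> P \<Longrightarrow>
      V p q r s t \<bullet> V a b c d e \<le> V p q r s t \<bullet> V x1 x2 x3 x4 x5 \<Longrightarrow>
      x1 = a \<and> x2 = b \<and> x3 = c \<and> x4 = d \<and> x5 = e"
    and cone: "\<And>c1 c2 c3 c4 c5 x1 x2 x3 x4 x5. V x1 x2 x3 x4 x5 \<in> P \<Longrightarrow>
      (\<And>n. n \<in> N \<Longrightarrow> V c1 c2 c3 c4 c5 \<bullet> n \<le> V c1 c2 c3 c4 c5 \<bullet> V a b c d e) \<Longrightarrow>
      V c1 c2 c3 c4 c5 \<bullet> V x1 x2 x3 x4 x5 \<le> V c1 c2 c3 c4 c5 \<bullet> V a b c d e"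
  shows "spanned (V a b c d e)"
proof -
  have "\<forall>x \<in> P. V p q r s t \<bullet> V a b c d e \<le> V p q r s t \<bullet> x \<longrightarrow> x = V a b c d e"
  proof (intro ballI impI)
    fix x assume "x \<in> P" "V p q r s t \<bullet> V a b c d e \<le> V p q r s t \<bullet> x"
    then show "x = V a b c d e"
      using k by (cases x rule: V_cases) (simp del: inner_V)
  qed
  moreover have "\<forall>k. (\<forall>n \<in> N. k \<bullet> n \<le> k \<bullet> V a b c d e) \<longrightarrow> (\<forall>x \<in> P. k \<bullet> x \<le> k \<bullet> V a b c d e)"
  proof (intro allI ballI impI)
    fix k x assume "\<forall>n \<in> N. k \<bullet> n \<le> k \<bullet> V a b c d e" "x \<in> P"
    then show "k \<bullet> x \<le> k \<bullet> V a b c d e"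
      using cone by (cases x rule: V_cases; cases k rule: V_cases) (simp del: inner_V)
  qed
  moreover have "\<forall>n \<in> N. \<bar>level (V a b c d e $ 5) - level (n $ 5)\<bar> \<le> 1"
    using assms(2) by simp
  ultimately show ?thesis
    unfolding spanned_def using assms(1) by blast
qed

section \<open>Cones at the vertices\<close>

text \<open>For a simple vertex \<open>w\<close> with neighbours \<open>n\<^sub>j\<close>, the slack \<open>s\<^sub>j\<close> of the facet missing \<open>n\<^sub>j\<close> is the
  coordinate of \<open>x - w\<close> along \<open>n\<^sub>j - w\<close>, up to a factor. So \<open>c \<bullet> (w - x)\<close> is a nonnegative combination
  of the products of \<open>s\<^sub>j\<close> and \<open>c \<bullet> (w - n\<^sub>j)\<close>. The two vertices with six neighbours have a cone
  that the hyperplane of the case distinction cuts into two simplicial ones.\<close>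

lemma le_if_nonneg_combination:
  fixes u v t1 t2 t3 t4 t5 :: real
  assumes "0 \<le> t1" "0 \<le> t2" "0 \<le> t3" "0 \<le> t4" "0 \<le> t5"
    and "K * (u - v) = k1 * t1 + k2 * t2 + k3 * t3 + k4 * t4 + k5 * t5"
    and "0 < K" "0 \<le> k1" "0 \<le> k2" "0 \<le> k3" "0 \<le> k4" "0 \<le> k5"
  shows "v \<le> u"
proof -
  have "0 \<le> K * (u - v)"
    unfolding assms(6) using assms by simp
  then show ?thesis using \<open>0 < K\<close> by (simp add: zero_le_mult_iff)
qed

lemma spanned_120_600_120_240: "spanned (V 120 600 120 240 8100)"
proof (rule spannedI [where p = "25" and q = "88" and r = "70" and s = "115" and t = "5" and
    N = "{V (- 120) 600 120 240 8100,
      V 0 0 0 0 18900,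
      V 120 600 (- 120) 240 8100,
      V 120 600 120 (- 240) 8100,
      V 140 560 140 280 6300,
      V 280 560 175 245 6300}"])
  let ?N = "{V (- 120) 600 120 240 8100,
      V 0 0 0 0 18900,
      V 120 600 (- 120) 240 8100,
      V 120 600 120 (- 240) 8100,
      V 140 560 140 280 6300,
      V 280 560 175 245 6300}"
  show "?N \<subseteq> S"
    by (simp add: S_def V_in_T apex_def abs_vertices_def)
  show "\<forall>n \<in> ?N. \<bar>level 8100 - level (n $ 5)\<bar> \<le> 1"
    by simp
  show "x1 = 120 \<and> x2 = 600 \<and> x3 = 120 \<and> x4 = 240 \<and> x5 = 8100"
    if x: "V x1 x2 x3 x4 x5 \<in> P" and k: "V 25 88 70 115 5 \<bullet> V 120 600 120 240 8100 \<le> V 25 88 70 115 5 \<bullet> V x1 x2 x3 x4 x5"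
    for x1 x2 x3 x4 x5
  proof -
    have "0 \<le> 18900 - 45 * x4 - x5"
      using facet_ineq [OF x, of 0 0 0 45 1] by (simp add: facet_normals_def)
    moreover have "0 \<le> 18900 - 30 * x3 - 30 * x4 - x5"
      using facet_ineq [OF x, of 0 0 30 30 1] by (simp add: facet_normals_def)
    moreover have "0 \<le> 18900 - 10 * x2 - 40 * x3 - x5"
      using facet_ineq [OF x, of 0 10 40 0 1] by (simp add: facet_normals_def)
    moreover have "0 \<le> 18900 - 18 * x2 - x5"
      using facet_ineq [OF x, of 0 18 0 0 1] by (simp add: facet_normals_def)
    moreover have "0 \<le> 18900 - 45 * x2 + x5"
      using facet_ineq [OF x, of 0 45 0 0 "- 1"] by (simp add: facet_normals_def)
    moreover have "0 \<le> 18900 - 10 * x1 - 40 * x4 - x5"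
      using facet_ineq [OF x, of 10 0 0 40 1] by (simp add: facet_normals_def)
    moreover have "0 \<le> 18900 - 15 * x1 - 15 * x2 - x5"
      using facet_ineq [OF x, of 15 15 0 0 1] by (simp add: facet_normals_def)
    ultimately show ?thesis using k by simp
  qed
  show "V c1 c2 c3 c4 c5 \<bullet> V x1 x2 x3 x4 x5 \<le> V c1 c2 c3 c4 c5 \<bullet> V 120 600 120 240 8100"
    if x: "V x1 x2 x3 x4 x5 \<in> P"
      and N: "\<And>n. n \<in> ?N \<Longrightarrow> V c1 c2 c3 c4 c5 \<bullet> n \<le> V c1 c2 c3 c4 c5 \<bullet> V 120 600 120 240 8100"
    for c1 c2 c3 c4 c5 x1 x2 x3 x4 x5
  \<comment> \<open>The hyperplane passes through the vertex and the four neighbours that occur in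
    both cases. Of the other two, \<open>V 120 600 120 (- 240) 8100\<close> lies on its positive and
    \<open>V 140 560 140 280 6300\<close> on its negative side.\<close>
  proof (cases "0 \<le> 18900 + 30 * x2 - 120 * x4 - x5")
    case True
    then have h: "0 \<le> 18900 + 30 * x2 - 120 * x4 - x5" by simp
    have "0 \<le> (18900 - 15 * x1 - 15 * x2 - x5) * (240 * c1)"
      using facet_ineq [OF x, of 15 15 0 0 1]
        N [of "V (- 120) 600 120 240 8100"] by (intro mult_nonneg_nonneg) (simp_all add: facet_normals_def)
    moreover have "0 \<le> (18900 - 45 * x2 + x5) * (120 * c1 + 600 * c2 + 120 * c3 + 240 * c4 - 10800 * c5)"
      using facet_ineq [OF x, of 0 45 0 0 "- 1"]
        N [of "V 0 0 0 0 18900"] by (intro mult_nonneg_nonneg) (simp_all add: facet_normals_def)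
    moreover have "0 \<le> (18900 - 10 * x2 - 40 * x3 - x5) * (240 * c3)"
      using facet_ineq [OF x, of 0 10 40 0 1]
        N [of "V 120 600 (- 120) 240 8100"] by (intro mult_nonneg_nonneg) (simp_all add: facet_normals_def)
    moreover have "0 \<le> (18900 + 30 * x2 - 120 * x4 - x5) * (480 * c4)"
      using h
        N [of "V 120 600 120 (- 240) 8100"] by (intro mult_nonneg_nonneg) (simp_all add: facet_normals_def)
    moreover have "0 \<le> (18900 - 18 * x2 - x5) * (- (160 * c1) + 40 * c2 - 55 * c3 - 5 * c4 + 1800 * c5)"
      using facet_ineq [OF x, of 0 18 0 0 1]
        N [of "V 280 560 175 245 6300"] by (intro mult_nonneg_nonneg) (simp_all add: facet_normals_def)
    \<comment> \<open>Each coefficient is 1209600 divided by the value of the slack at the neighbour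
      paired with it, and 1209600 is the least common multiple of these five values. The constants
      of the later identities arise in the same way.\<close>
    moreover have "1209600 * (V c1 c2 c3 c4 c5 \<bullet> V 120 600 120 240 8100 - V c1 c2 c3 c4 c5 \<bullet> V x1 x2 x3 x4 x5) =
      336 * ((18900 - 15 * x1 - 15 * x2 - x5) * (240 * c1))
        + 32 * ((18900 - 45 * x2 + x5) * (120 * c1 + 600 * c2 + 120 * c3 + 240 * c4 - 10800 * c5))
        + 126 * ((18900 - 10 * x2 - 40 * x3 - x5) * (240 * c3))
        + 21 * ((18900 + 30 * x2 - 120 * x4 - x5) * (480 * c4))
        + 480 * ((18900 - 18 * x2 - x5) * (- (160 * c1) + 40 * c2 - 55 * c3 - 5 * c4 + 1800 * c5))"
      by (simp only: inner_V) algebra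
    ultimately show ?thesis by (rule le_if_nonneg_combination) simp_all
  next
    case False
    then have h: "0 \<le> - 18900 - 30 * x2 + 120 * x4 + x5" by simp
    have "0 \<le> (18900 - 10 * x1 - 40 * x4 - x5) * (240 * c1)"
      using facet_ineq [OF x, of 10 0 0 40 1]
        N [of "V (- 120) 600 120 240 8100"] by (intro mult_nonneg_nonneg) (simp_all add: facet_normals_def)
    moreover have "0 \<le> (18900 - 45 * x2 + x5) * (120 * c1 + 600 * c2 + 120 * c3 + 240 * c4 - 10800 * c5)"
      using facet_ineq [OF x, of 0 45 0 0 "- 1"]
        N [of "V 0 0 0 0 18900"] by (intro mult_nonneg_nonneg) (simp_all add: facet_normals_def)
    moreover have "0 \<le> (18900 - 30 * x3 - 30 * x4 - x5) * (240 * c3)"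
      using facet_ineq [OF x, of 0 0 30 30 1]
        N [of "V 120 600 (- 120) 240 8100"] by (intro mult_nonneg_nonneg) (simp_all add: facet_normals_def)
    moreover have "0 \<le> (- 18900 - 30 * x2 + 120 * x4 + x5) * (- (20 * c1) + 40 * c2 - 20 * c3 - 40 * c4 + 1800 * c5)"
      using h
        N [of "V 140 560 140 280 6300"] by (intro mult_nonneg_nonneg) (simp_all add: facet_normals_def)
    moreover have "0 \<le> (18900 - 45 * x4 - x5) * (- (160 * c1) + 40 * c2 - 55 * c3 - 5 * c4 + 1800 * c5)"
      using facet_ineq [OF x, of 0 0 0 45 1]
        N [of "V 280 560 175 245 6300"] by (intro mult_nonneg_nonneg) (simp_all add: facet_normals_def)
    moreover have "151200 * (V c1 c2 c3 c4 c5 \<bullet> V 120 600 120 240 8100 - V c1 c2 c3 c4 c5 \<bullet> V x1 x2 x3 x4 x5) =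
      63 * ((18900 - 10 * x1 - 40 * x4 - x5) * (240 * c1))
        + 4 * ((18900 - 45 * x2 + x5) * (120 * c1 + 600 * c2 + 120 * c3 + 240 * c4 - 10800 * c5))
        + 21 * ((18900 - 30 * x3 - 30 * x4 - x5) * (240 * c3))
        + 36 * ((- 18900 - 30 * x2 + 120 * x4 + x5) * (- (20 * c1) + 40 * c2 - 20 * c3 - 40 * c4 + 1800 * c5))
        + 96 * ((18900 - 45 * x4 - x5) * (- (160 * c1) + 40 * c2 - 55 * c3 - 5 * c4 + 1800 * c5))"
      by (simp only: inner_V) algebra
    ultimately show ?thesis by (rule le_if_nonneg_combination) simp_all
  qed
qed

lemma spanned_140_560_140_280: "spanned (V 140 560 140 280 6300)"
proof (rule spannedI [where p = "10" and q = "85" and r = "30" and s = "125" and t = "1" and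
    N = "{V (- 140) 560 140 280 6300,
      V 120 600 120 240 8100,
      V 140 560 (- 140) 280 6300,
      V 252 252 252 504 (- 3780),
      V 270 540 180 270 5400}"])
  let ?N = "{V (- 140) 560 140 280 6300,
      V 120 600 120 240 8100,
      V 140 560 (- 140) 280 6300,
      V 252 252 252 504 (- 3780),
      V 270 540 180 270 5400}"
  show "?N \<subseteq> S"
    by (simp add: S_def V_in_T apex_def abs_vertices_def)
  show "\<forall>n \<in> ?N. \<bar>level 6300 - level (n $ 5)\<bar> \<le> 1"
    by simp
  show "x1 = 140 \<and> x2 = 560 \<and> x3 = 140 \<and> x4 = 280 \<and> x5 = 6300"
    if x: "V x1 x2 x3 x4 x5 \<in> P" and k: "V 10 85 30 125 1 \<bullet> V 140 560 140 280 6300 \<le> V 10 85 30 125 1 \<bullet> V x1 x2 x3 x4 x5"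
    for x1 x2 x3 x4 x5
  proof -
    have "0 \<le> 18900 - 45 * x4 - x5"
      using facet_ineq [OF x, of 0 0 0 45 1] by (simp add: facet_normals_def)
    moreover have "0 \<le> 18900 - 30 * x3 - 30 * x4 - x5"
      using facet_ineq [OF x, of 0 0 30 30 1] by (simp add: facet_normals_def)
    moreover have "0 \<le> 18900 - 40 * x2 - 10 * x4 + x5"
      using facet_ineq [OF x, of 0 40 0 10 "- 1"] by (simp add: facet_normals_def)
    moreover have "0 \<le> 18900 - 45 * x2 + x5"
      using facet_ineq [OF x, of 0 45 0 0 "- 1"] by (simp add: facet_normals_def)
    moreover have "0 \<le> 18900 - 10 * x1 - 40 * x4 - x5"
      using facet_ineq [OF x, of 10 0 0 40 1] by (simp add: facet_normals_def)
    ultimately show ?thesis using k by simp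
  qed
  show "V c1 c2 c3 c4 c5 \<bullet> V x1 x2 x3 x4 x5 \<le> V c1 c2 c3 c4 c5 \<bullet> V 140 560 140 280 6300"
    if x: "V x1 x2 x3 x4 x5 \<in> P"
      and N: "\<And>n. n \<in> ?N \<Longrightarrow> V c1 c2 c3 c4 c5 \<bullet> n \<le> V c1 c2 c3 c4 c5 \<bullet> V 140 560 140 280 6300"
    for c1 c2 c3 c4 c5 x1 x2 x3 x4 x5
  proof -
    have "0 \<le> (18900 - 10 * x1 - 40 * x4 - x5) * (280 * c1)"
      using facet_ineq [OF x, of 10 0 0 40 1]
        N [of "V (- 140) 560 140 280 6300"] by (intro mult_nonneg_nonneg) (simp_all add: facet_normals_def)
    moreover have "0 \<le> (18900 - 40 * x2 - 10 * x4 + x5) * (20 * c1 - 40 * c2 + 20 * c3 + 40 * c4 - 1800 * c5)"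
      using facet_ineq [OF x, of 0 40 0 10 "- 1"]
        N [of "V 120 600 120 240 8100"] by (intro mult_nonneg_nonneg) (simp_all add: facet_normals_def)
    moreover have "0 \<le> (18900 - 30 * x3 - 30 * x4 - x5) * (280 * c3)"
      using facet_ineq [OF x, of 0 0 30 30 1]
        N [of "V 140 560 (- 140) 280 6300"] by (intro mult_nonneg_nonneg) (simp_all add: facet_normals_def)
    moreover have "0 \<le> (18900 - 45 * x2 + x5) * (- (112 * c1) + 308 * c2 - 112 * c3 - 224 * c4 + 10080 * c5)"
      using facet_ineq [OF x, of 0 45 0 0 "- 1"]
        N [of "V 252 252 252 504 (- 3780)"] by (intro mult_nonneg_nonneg) (simp_all add: facet_normals_def)
    moreover have "0 \<le> (18900 - 45 * x4 - x5) * (- (130 * c1) + 20 * c2 - 40 * c3 + 10 * c4 + 900 * c5)"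
      using facet_ineq [OF x, of 0 0 0 45 1]
        N [of "V 270 540 180 270 5400"] by (intro mult_nonneg_nonneg) (simp_all add: facet_normals_def)
    moreover have "75600 * (V c1 c2 c3 c4 c5 \<bullet> V 140 560 140 280 6300 - V c1 c2 c3 c4 c5 \<bullet> V x1 x2 x3 x4 x5) =
      27 * ((18900 - 10 * x1 - 40 * x4 - x5) * (280 * c1))
        + 126 * ((18900 - 40 * x2 - 10 * x4 + x5) * (20 * c1 - 40 * c2 + 20 * c3 + 40 * c4 - 1800 * c5))
        + 9 * ((18900 - 30 * x3 - 30 * x4 - x5) * (280 * c3))
        + 20 * ((18900 - 45 * x2 + x5) * (- (112 * c1) + 308 * c2 - 112 * c3 - 224 * c4 + 10080 * c5))
        + 56 * ((18900 - 45 * x4 - x5) * (- (130 * c1) + 20 * c2 - 40 * c3 + 10 * c4 + 900 * c5))"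
      by (simp only: inner_V) algebra
    ultimately show ?thesis by (rule le_if_nonneg_combination) simp_all
  qed
qed

lemma spanned_280_560_175_245: "spanned (V 280 560 175 245 6300)"
proof (rule spannedI [where p = "55" and q = "100" and r = "70" and s = "70" and t = "2" and
    N = "{V 120 600 120 240 8100,
      V 252 504 252 252 3780,
      V 270 540 180 270 5400,
      V 280 560 (- 175) 245 6300,
      V 280 560 175 (- 245) 6300,
      V 560 280 245 175 6300}"])
  let ?N = "{V 120 600 120 240 8100,
      V 252 504 252 252 3780,
      V 270 540 180 270 5400,
      V 280 560 (- 175) 245 6300,
      V 280 560 175 (- 245) 6300,
      V 560 280 245 175 6300}"
  show "?N \<subseteq> S"
    by (simp add: S_def V_in_T apex_def abs_vertices_def)
  show "\<forall>n \<in> ?N. \<bar>level 6300 - level (n $ 5)\<bar> \<le> 1"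
    by simp
  show "x1 = 280 \<and> x2 = 560 \<and> x3 = 175 \<and> x4 = 245 \<and> x5 = 6300"
    if x: "V x1 x2 x3 x4 x5 \<in> P" and k: "V 55 100 70 70 2 \<bullet> V 280 560 175 245 6300 \<le> V 55 100 70 70 2 \<bullet> V x1 x2 x3 x4 x5"
    for x1 x2 x3 x4 x5
  proof -
    have "0 \<le> 18900 - 30 * x3 - 30 * x4 - x5"
      using facet_ineq [OF x, of 0 0 30 30 1] by (simp add: facet_normals_def)
    moreover have "0 \<le> 18900 - 10 * x2 - 40 * x3 - x5"
      using facet_ineq [OF x, of 0 10 40 0 1] by (simp add: facet_normals_def)
    moreover have "0 \<le> 18900 - 45 * x2 + x5"
      using facet_ineq [OF x, of 0 45 0 0 "- 1"] by (simp add: facet_normals_def)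
    moreover have "0 \<le> 18900 - 10 * x1 - 40 * x4 - x5"
      using facet_ineq [OF x, of 10 0 0 40 1] by (simp add: facet_normals_def)
    moreover have "0 \<le> 18900 - 15 * x1 - 15 * x2 - x5"
      using facet_ineq [OF x, of 15 15 0 0 1] by (simp add: facet_normals_def)
    moreover have "0 \<le> 18900 - 30 * x1 - 30 * x2 + x5"
      using facet_ineq [OF x, of 30 30 0 0 "- 1"] by (simp add: facet_normals_def)
    ultimately show ?thesis using k by simp
  qed
  show "V c1 c2 c3 c4 c5 \<bullet> V x1 x2 x3 x4 x5 \<le> V c1 c2 c3 c4 c5 \<bullet> V 280 560 175 245 6300"
    if x: "V x1 x2 x3 x4 x5 \<in> P"
      and N: "\<And>n. n \<in> ?N \<Longrightarrow> V c1 c2 c3 c4 c5 \<bullet> n \<le> V c1 c2 c3 c4 c5 \<bullet> V 280 560 175 245 6300"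
    for c1 c2 c3 c4 c5 x1 x2 x3 x4 x5
  \<comment> \<open>The same hyperplane as at \<open>V 120 600 120 240 8100\<close>. Here
    \<open>V 280 560 175 (- 245) 6300\<close> is on its positive side,
    \<open>V 270 540 180 270 5400\<close> on its negative side, and the other four neighbours lie on
    it.\<close>
  proof (cases "0 \<le> 18900 + 30 * x2 - 120 * x4 - x5")
    case True
    then have h: "0 \<le> 18900 + 30 * x2 - 120 * x4 - x5" by simp
    have "0 \<le> (18900 - 30 * x1 - 30 * x2 + x5) * (160 * c1 - 40 * c2 + 55 * c3 + 5 * c4 - 1800 * c5)"
      using facet_ineq [OF x, of 30 30 0 0 "- 1"]
        N [of "V 120 600 120 240 8100"] by (intro mult_nonneg_nonneg) (simp_all add: facet_normals_def)
    moreover have "0 \<le> (18900 - 15 * x1 - 15 * x2 - x5) * (28 * c1 + 56 * c2 - 77 * c3 - 7 * c4 + 2520 * c5)"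
      using facet_ineq [OF x, of 15 15 0 0 1]
        N [of "V 252 504 252 252 3780"] by (intro mult_nonneg_nonneg) (simp_all add: facet_normals_def)
    moreover have "0 \<le> (18900 - 10 * x2 - 40 * x3 - x5) * (350 * c3)"
      using facet_ineq [OF x, of 0 10 40 0 1]
        N [of "V 280 560 (- 175) 245 6300"] by (intro mult_nonneg_nonneg) (simp_all add: facet_normals_def)
    moreover have "0 \<le> (18900 + 30 * x2 - 120 * x4 - x5) * (490 * c4)"
      using h
        N [of "V 280 560 175 (- 245) 6300"] by (intro mult_nonneg_nonneg) (simp_all add: facet_normals_def)
    moreover have "0 \<le> (18900 - 45 * x2 + x5) * (- (280 * c1) + 280 * c2 - 70 * c3 + 70 * c4)"
      using facet_ineq [OF x, of 0 45 0 0 "- 1"]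
        N [of "V 560 280 245 175 6300"] by (intro mult_nonneg_nonneg) (simp_all add: facet_normals_def)
    moreover have "2646000 * (V c1 c2 c3 c4 c5 \<bullet> V 280 560 175 245 6300 - V c1 c2 c3 c4 c5 \<bullet> V x1 x2 x3 x4 x5) =
      490 * ((18900 - 30 * x1 - 30 * x2 + x5) * (160 * c1 - 40 * c2 + 55 * c3 + 5 * c4 - 1800 * c5))
        + 700 * ((18900 - 15 * x1 - 15 * x2 - x5) * (28 * c1 + 56 * c2 - 77 * c3 - 7 * c4 + 2520 * c5))
        + 189 * ((18900 - 10 * x2 - 40 * x3 - x5) * (350 * c3))
        + 45 * ((18900 + 30 * x2 - 120 * x4 - x5) * (490 * c4))
        + 210 * ((18900 - 45 * x2 + x5) * (- (280 * c1) + 280 * c2 - 70 * c3 + 70 * c4))"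
      by (simp only: inner_V) algebra
    ultimately show ?thesis by (rule le_if_nonneg_combination) simp_all
  next
    case False
    then have h: "0 \<le> - 18900 - 30 * x2 + 120 * x4 + x5" by simp
    have "0 \<le> (18900 - 30 * x1 - 30 * x2 + x5) * (160 * c1 - 40 * c2 + 55 * c3 + 5 * c4 - 1800 * c5)"
      using facet_ineq [OF x, of 30 30 0 0 "- 1"]
        N [of "V 120 600 120 240 8100"] by (intro mult_nonneg_nonneg) (simp_all add: facet_normals_def)
    moreover have "0 \<le> (18900 - 10 * x1 - 40 * x4 - x5) * (28 * c1 + 56 * c2 - 77 * c3 - 7 * c4 + 2520 * c5)"
      using facet_ineq [OF x, of 10 0 0 40 1]
        N [of "V 252 504 252 252 3780"] by (intro mult_nonneg_nonneg) (simp_all add: facet_normals_def)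
    moreover have "0 \<le> (- 18900 - 30 * x2 + 120 * x4 + x5) * (10 * c1 + 20 * c2 - 5 * c3 - 25 * c4 + 900 * c5)"
      using h
        N [of "V 270 540 180 270 5400"] by (intro mult_nonneg_nonneg) (simp_all add: facet_normals_def)
    moreover have "0 \<le> (18900 - 30 * x3 - 30 * x4 - x5) * (350 * c3)"
      using facet_ineq [OF x, of 0 0 30 30 1]
        N [of "V 280 560 (- 175) 245 6300"] by (intro mult_nonneg_nonneg) (simp_all add: facet_normals_def)
    moreover have "0 \<le> (18900 - 45 * x2 + x5) * (- (280 * c1) + 280 * c2 - 70 * c3 + 70 * c4)"
      using facet_ineq [OF x, of 0 45 0 0 "- 1"]
        N [of "V 560 280 245 175 6300"] by (intro mult_nonneg_nonneg) (simp_all add: facet_normals_def)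
    moreover have "189000 * (V c1 c2 c3 c4 c5 \<bullet> V 280 560 175 245 6300 - V c1 c2 c3 c4 c5 \<bullet> V x1 x2 x3 x4 x5) =
      35 * ((18900 - 30 * x1 - 30 * x2 + x5) * (160 * c1 - 40 * c2 + 55 * c3 + 5 * c4 - 1800 * c5))
        + 75 * ((18900 - 10 * x1 - 40 * x4 - x5) * (28 * c1 + 56 * c2 - 77 * c3 - 7 * c4 + 2520 * c5))
        + 70 * ((- 18900 - 30 * x2 + 120 * x4 + x5) * (10 * c1 + 20 * c2 - 5 * c3 - 25 * c4 + 900 * c5))
        + 18 * ((18900 - 30 * x3 - 30 * x4 - x5) * (350 * c3))
        + 15 * ((18900 - 45 * x2 + x5) * (- (280 * c1) + 280 * c2 - 70 * c3 + 70 * c4))"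
      by (simp only: inner_V) algebra
    ultimately show ?thesis by (rule le_if_nonneg_combination) simp_all
  qed
qed

lemma spanned_252_252_252_504: "spanned (V 252 252 252 504 (- 3780))"
proof (rule spannedI [where p = "40" and q = "70" and r = "30" and s = "125" and t = "1" and
    N = "{V 140 560 140 280 6300,
      V 245 175 280 560 (- 6300),
      V 252 252 (- 252) 504 (- 3780),
      V 270 180 270 540 (- 5400),
      V 270 540 180 270 5400}"])
  let ?N = "{V 140 560 140 280 6300,
      V 245 175 280 560 (- 6300),
      V 252 252 (- 252) 504 (- 3780),
      V 270 180 270 540 (- 5400),
      V 270 540 180 270 5400}"
  show "?N \<subseteq> S"
    by (simp add: S_def V_in_T apex_def abs_vertices_def)
  show "\<forall>n \<in> ?N. \<bar>level (- 3780) - level (n $ 5)\<bar> \<le> 1"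
    by simp
  show "x1 = 252 \<and> x2 = 252 \<and> x3 = 252 \<and> x4 = 504 \<and> x5 = - 3780"
    if x: "V x1 x2 x3 x4 x5 \<in> P" and k: "V 40 70 30 125 1 \<bullet> V 252 252 252 504 (- 3780) \<le> V 40 70 30 125 1 \<bullet> V x1 x2 x3 x4 x5"
    for x1 x2 x3 x4 x5
  proof -
    have "0 \<le> 18900 - 45 * x4 - x5"
      using facet_ineq [OF x, of 0 0 0 45 1] by (simp add: facet_normals_def)
    moreover have "0 \<le> 18900 - 30 * x3 - 30 * x4 - x5"
      using facet_ineq [OF x, of 0 0 30 30 1] by (simp add: facet_normals_def)
    moreover have "0 \<le> 18900 - 40 * x2 - 10 * x4 + x5"
      using facet_ineq [OF x, of 0 40 0 10 "- 1"] by (simp add: facet_normals_def)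
    moreover have "0 \<le> 18900 - 10 * x1 - 40 * x4 - x5"
      using facet_ineq [OF x, of 10 0 0 40 1] by (simp add: facet_normals_def)
    moreover have "0 \<le> 18900 - 30 * x1 - 30 * x2 + x5"
      using facet_ineq [OF x, of 30 30 0 0 "- 1"] by (simp add: facet_normals_def)
    ultimately show ?thesis using k by simp
  qed
  show "V c1 c2 c3 c4 c5 \<bullet> V x1 x2 x3 x4 x5 \<le> V c1 c2 c3 c4 c5 \<bullet> V 252 252 252 504 (- 3780)"
    if x: "V x1 x2 x3 x4 x5 \<in> P"
      and N: "\<And>n. n \<in> ?N \<Longrightarrow> V c1 c2 c3 c4 c5 \<bullet> n \<le> V c1 c2 c3 c4 c5 \<bullet> V 252 252 252 504 (- 3780)"
    for c1 c2 c3 c4 c5 x1 x2 x3 x4 x5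
  proof -
    have "0 \<le> (18900 - 30 * x1 - 30 * x2 + x5) * (112 * c1 - 308 * c2 + 112 * c3 + 224 * c4 - 10080 * c5)"
      using facet_ineq [OF x, of 30 30 0 0 "- 1"]
        N [of "V 140 560 140 280 6300"] by (intro mult_nonneg_nonneg) (simp_all add: facet_normals_def)
    moreover have "0 \<le> (18900 - 10 * x1 - 40 * x4 - x5) * (7 * c1 + 77 * c2 - 28 * c3 - 56 * c4 + 2520 * c5)"
      using facet_ineq [OF x, of 10 0 0 40 1]
        N [of "V 245 175 280 560 (- 6300)"] by (intro mult_nonneg_nonneg) (simp_all add: facet_normals_def)
    moreover have "0 \<le> (18900 - 30 * x3 - 30 * x4 - x5) * (504 * c3)"
      using facet_ineq [OF x, of 0 0 30 30 1]
        N [of "V 252 252 (- 252) 504 (- 3780)"] by (intro mult_nonneg_nonneg) (simp_all add: facet_normals_def)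
    moreover have "0 \<le> (18900 - 40 * x2 - 10 * x4 + x5) * (- (18 * c1) + 72 * c2 - 18 * c3 - 36 * c4 + 1620 * c5)"
      using facet_ineq [OF x, of 0 40 0 10 "- 1"]
        N [of "V 270 180 270 540 (- 5400)"] by (intro mult_nonneg_nonneg) (simp_all add: facet_normals_def)
    moreover have "0 \<le> (18900 - 45 * x4 - x5) * (- (18 * c1) - 288 * c2 + 72 * c3 + 234 * c4 - 9180 * c5)"
      using facet_ineq [OF x, of 0 0 0 45 1]
        N [of "V 270 540 180 270 5400"] by (intro mult_nonneg_nonneg) (simp_all add: facet_normals_def)
    moreover have "75600 * (V c1 c2 c3 c4 c5 \<bullet> V 252 252 252 504 (- 3780) - V c1 c2 c3 c4 c5 \<bullet> V x1 x2 x3 x4 x5) =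
      18 * ((18900 - 30 * x1 - 30 * x2 + x5) * (112 * c1 - 308 * c2 + 112 * c3 + 224 * c4 - 10080 * c5))
        + 216 * ((18900 - 10 * x1 - 40 * x4 - x5) * (7 * c1 + 77 * c2 - 28 * c3 - 56 * c4 + 2520 * c5))
        + 5 * ((18900 - 30 * x3 - 30 * x4 - x5) * (504 * c3))
        + 84 * ((18900 - 40 * x2 - 10 * x4 + x5) * (- (18 * c1) + 72 * c2 - 18 * c3 - 36 * c4 + 1620 * c5))
        + 56 * ((18900 - 45 * x4 - x5) * (- (18 * c1) - 288 * c2 + 72 * c3 + 234 * c4 - 9180 * c5))"
      by (simp only: inner_V) algebra
    ultimately show ?thesis by (rule le_if_nonneg_combination) simp_all
  qed
qed

lemma spanned_270_540_180_270: "spanned (V 270 540 180 270 5400)"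
proof (rule spannedI [where p = "40" and q = "115" and r = "30" and s = "80" and t = "- 1" and
    N = "{V 140 560 140 280 6300,
      V 252 252 252 504 (- 3780),
      V 252 504 252 252 3780,
      V 270 540 (- 180) 270 5400,
      V 280 560 175 245 6300}"])
  let ?N = "{V 140 560 140 280 6300,
      V 252 252 252 504 (- 3780),
      V 252 504 252 252 3780,
      V 270 540 (- 180) 270 5400,
      V 280 560 175 245 6300}"
  show "?N \<subseteq> S"
    by (simp add: S_def V_in_T apex_def abs_vertices_def)
  show "\<forall>n \<in> ?N. \<bar>level 5400 - level (n $ 5)\<bar> \<le> 1"
    by simp
  show "x1 = 270 \<and> x2 = 540 \<and> x3 = 180 \<and> x4 = 270 \<and> x5 = 5400"
    if x: "V x1 x2 x3 x4 x5 \<in> P" and k: "V 40 115 30 80 (- 1) \<bullet> V 270 540 180 270 5400 \<le> V 40 115 30 80 (- 1) \<bullet> V x1 x2 x3 x4 x5"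
    for x1 x2 x3 x4 x5
  proof -
    have "0 \<le> 18900 - 30 * x3 - 30 * x4 - x5"
      using facet_ineq [OF x, of 0 0 30 30 1] by (simp add: facet_normals_def)
    moreover have "0 \<le> 18900 - 40 * x2 - 10 * x4 + x5"
      using facet_ineq [OF x, of 0 40 0 10 "- 1"] by (simp add: facet_normals_def)
    moreover have "0 \<le> 18900 - 45 * x2 + x5"
      using facet_ineq [OF x, of 0 45 0 0 "- 1"] by (simp add: facet_normals_def)
    moreover have "0 \<le> 18900 - 10 * x1 - 40 * x4 - x5"
      using facet_ineq [OF x, of 10 0 0 40 1] by (simp add: facet_normals_def)
    moreover have "0 \<le> 18900 - 30 * x1 - 30 * x2 + x5"
      using facet_ineq [OF x, of 30 30 0 0 "- 1"] by (simp add: facet_normals_def)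
    ultimately show ?thesis using k by simp
  qed
  show "V c1 c2 c3 c4 c5 \<bullet> V x1 x2 x3 x4 x5 \<le> V c1 c2 c3 c4 c5 \<bullet> V 270 540 180 270 5400"
    if x: "V x1 x2 x3 x4 x5 \<in> P"
      and N: "\<And>n. n \<in> ?N \<Longrightarrow> V c1 c2 c3 c4 c5 \<bullet> n \<le> V c1 c2 c3 c4 c5 \<bullet> V 270 540 180 270 5400"
    for c1 c2 c3 c4 c5 x1 x2 x3 x4 x5
  proof -
    have "0 \<le> (18900 - 30 * x1 - 30 * x2 + x5) * (130 * c1 - 20 * c2 + 40 * c3 - 10 * c4 - 900 * c5)"
      using facet_ineq [OF x, of 30 30 0 0 "- 1"]
        N [of "V 140 560 140 280 6300"] by (intro mult_nonneg_nonneg) (simp_all add: facet_normals_def)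
    moreover have "0 \<le> (18900 - 45 * x2 + x5) * (18 * c1 + 288 * c2 - 72 * c3 - 234 * c4 + 9180 * c5)"
      using facet_ineq [OF x, of 0 45 0 0 "- 1"]
        N [of "V 252 252 252 504 (- 3780)"] by (intro mult_nonneg_nonneg) (simp_all add: facet_normals_def)
    moreover have "0 \<le> (18900 - 10 * x1 - 40 * x4 - x5) * (18 * c1 + 36 * c2 - 72 * c3 + 18 * c4 + 1620 * c5)"
      using facet_ineq [OF x, of 10 0 0 40 1]
        N [of "V 252 504 252 252 3780"] by (intro mult_nonneg_nonneg) (simp_all add: facet_normals_def)
    moreover have "0 \<le> (18900 - 30 * x3 - 30 * x4 - x5) * (360 * c3)"
      using facet_ineq [OF x, of 0 0 30 30 1]
        N [of "V 270 540 (- 180) 270 5400"] by (intro mult_nonneg_nonneg) (simp_all add: facet_normals_def)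
    moreover have "0 \<le> (18900 - 40 * x2 - 10 * x4 + x5) * (- (10 * c1) - 20 * c2 + 5 * c3 + 25 * c4 - 900 * c5)"
      using facet_ineq [OF x, of 0 40 0 10 "- 1"]
        N [of "V 280 560 175 245 6300"] by (intro mult_nonneg_nonneg) (simp_all add: facet_normals_def)
    moreover have "75600 * (V c1 c2 c3 c4 c5 \<bullet> V 270 540 180 270 5400 - V c1 c2 c3 c4 c5 \<bullet> V x1 x2 x3 x4 x5) =
      18 * ((18900 - 30 * x1 - 30 * x2 + x5) * (130 * c1 - 20 * c2 + 40 * c3 - 10 * c4 - 900 * c5))
        + 20 * ((18900 - 45 * x2 + x5) * (18 * c1 + 288 * c2 - 72 * c3 - 234 * c4 + 9180 * c5))
        + 30 * ((18900 - 10 * x1 - 40 * x4 - x5) * (18 * c1 + 36 * c2 - 72 * c3 + 18 * c4 + 1620 * c5))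
        + 7 * ((18900 - 30 * x3 - 30 * x4 - x5) * (360 * c3))
        + 216 * ((18900 - 40 * x2 - 10 * x4 + x5) * (- (10 * c1) - 20 * c2 + 5 * c3 + 25 * c4 - 900 * c5))"
      by (simp only: inner_V) algebra
    ultimately show ?thesis by (rule le_if_nonneg_combination) simp_all
  qed
qed

text \<open>\<open>rot\<close> has order four, so the five representatives treated above account for
  all twenty tuples of \<open>abs_vertices\<close>.\<close>

lemma spanned_orbit:
  assumes "spanned (V a b c d e)"
  shows "spanned (V a b c d e) \<and> spanned (V c d b a (- e)) \<and> spanned (V b a d c e)
    \<and> spanned (V d c a b (- e))"
proof -
  have rot: "spanned (V c d b a (- e))" if "spanned (V a b c d e)" for a b c d e
    using spanned_rot [OF that] by (simp add: rot_def)
  from assms rot [OF assms] rot [OF rot [OF assms]] rot [OF rot [OF rot [OF assms]]]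
  show ?thesis by simp
qed

lemma spanned_abs_vertices:
  "(a, b, c, d, e) \<in> abs_vertices \<Longrightarrow> spanned (V a b c d e)"
  using spanned_orbit [OF spanned_120_600_120_240] spanned_orbit [OF spanned_140_560_140_280]
    spanned_orbit [OF spanned_280_560_175_245] spanned_orbit [OF spanned_252_252_252_504]
    spanned_orbit [OF spanned_270_540_180_270]
  unfolding abs_vertices_def by (elim insertE emptyE) simp_all

lemma spanned_T:
  assumes "w \<in> T"
  shows "spanned w"
proof -
  obtain g t where w: "w = vertex (g, t)" "g \<in> sign_vectors" "t \<in> abs_vertices"
    using assms unfolding T_def by blast
  obtain p q r s where g: "g = (p, q, r, s)" by (rule prod_cases4)
  obtain a b c d e where t: "t = (a, b, c, d, e)" by (rule prod_cases5)
  have "w = flip g (V a b c d e)"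
    using w(1) g t by simp
  then show ?thesis
    using spanned_flip spanned_abs_vertices w t by simp
qed

section \<open>The polytope as a convex hull\<close>

lemma extreme_point_if_unique_max:
  assumes "w \<in> A" "\<And>x. x \<in> A \<Longrightarrow> k \<bullet> w \<le> k \<bullet> x \<Longrightarrow> x = w"
  shows "w extreme_point_of A"
  unfolding extreme_point_of_def
proof (intro conjI ballI notI)
  fix a b assume ab: "a \<in> A" "b \<in> A" "w \<in> open_segment a b"
  then have "a \<noteq> w" "b \<noteq> w" by (auto simp: open_segment_def)
  then have less: "k \<bullet> a < k \<bullet> w" "k \<bullet> b < k \<bullet> w"
    using assms(2) ab by force+
  obtain u where u: "0 < u" "u < 1" "w = (1 - u) *\<^sub>R a + u *\<^sub>R b"
    using ab(3) by (auto simp: in_segment)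
  have "k \<bullet> w = (1 - u) * (k \<bullet> a) + u * (k \<bullet> b)"
    by (simp add: u(3) inner_add_right)
  also have "\<dots> < (1 - u) * (k \<bullet> w) + u * (k \<bullet> w)"
    using u less by (intro add_strict_mono mult_strict_left_mono) auto
  finally show False by (simp add: algebra_simps)
qed (use assms in auto)

lemma inner_apex [simp]: "x \<bullet> apex = x $ 5 * 18900"
  by (cases x rule: V_cases) (simp add: apex_def)

lemma apex_nth [simp]: "apex $ 5 = 18900"
  by (simp add: apex_def)

lemma P_abs_nth_5:
  assumes "x \<in> P"
  shows "\<bar>x $ 5\<bar> \<le> 18900" "x $ 5 = 18900 \<Longrightarrow> x = apex" "x $ 5 = - 18900 \<Longrightarrow> x = - apex"
  using assms by (cases x rule: V_cases; simp add: apex_def V_in_P_abs; linarith)+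

lemma S_extreme_point:
  assumes "w \<in> S"
  shows "w extreme_point_of P"
proof -
  consider "w = apex" | "w = - apex" | "w \<in> T"
    using assms by (auto simp: S_def)
  then show ?thesis
  proof cases
    case 1
    have "x = apex" if "x \<in> P" "V 0 0 0 0 1 \<bullet> apex \<le> V 0 0 0 0 1 \<bullet> x" for x
      using P_abs_nth_5 [OF that(1)] that(2) by (cases x rule: V_cases) simp
    with apex_in_P show ?thesis
      unfolding 1 by (intro extreme_point_if_unique_max)
  next
    case 2
    have "x = - apex" if "x \<in> P" "V 0 0 0 0 (- 1) \<bullet> - apex \<le> V 0 0 0 0 (- 1) \<bullet> x" for x
    proof -
      have "18900 \<le> - x $ 5"
        using that(2) by (cases x rule: V_cases) simp
      then have "x $ 5 = - 18900"
        using P_abs_nth_5(1) [OF that(1)] by linarith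
      then show ?thesis
        using P_abs_nth_5(3) [OF that(1)] by simp
    qed
    with apex_in_P show ?thesis
      unfolding 2 by (intro extreme_point_if_unique_max)
  next
    case 3
    then obtain k where "\<forall>x \<in> P. k \<bullet> w \<le> k \<bullet> x \<longrightarrow> x = w"
      using spanned_T unfolding spanned_def by blast
    with 3 T_subset_P show ?thesis
      by (intro extreme_point_if_unique_max) auto
  qed
qed

lemma spanned_max:
  assumes "spanned w" "\<And>s. s \<in> S \<Longrightarrow> c \<bullet> s \<le> c \<bullet> w" "x \<in> P"
  shows "c \<bullet> x \<le> c \<bullet> w"
proof -
  obtain N where "N \<subseteq> S" "\<forall>c. (\<forall>n \<in> N. c \<bullet> n \<le> c \<bullet> w) \<longrightarrow> (\<forall>x \<in> P. c \<bullet> x \<le> c \<bullet> w)"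
    using assms(1) unfolding spanned_def by (elim conjE exE) (rule that)
  with assms(2,3) show ?thesis by blast
qed

text \<open>Tilting the separating functional \<^term>\<open>c\<close> by a multiple of \<^term>\<open>f\<close>, which vanishes at both
  apices, yields a functional whose maximum over \<^const>\<open>S\<close> is attained in \<^const>\<open>T\<close>. Hence the
  cones at the apices need not be known.\<close>

lemma separated_imp_neg:
  assumes c: "\<And>s. s \<in> S \<Longrightarrow> c \<bullet> s < m" and x: "m < c \<bullet> x" "x \<in> P"
    and f: "f $ 5 = 0" "w \<in> T" "0 < f \<bullet> w"
  shows "f \<bullet> x < 0"
proof -
  \<comment> \<open>The largest ratio \<open>q w0\<close> is the right amount of tilting:
    \<open>f + q w0 *\<^sub>R c\<close> is at most \<open>q w0 * m\<close> on \<open>S\<close>, with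
    equality at \<open>w0\<close>. The cone at \<open>w0\<close> extends this bound to
    \<open>x\<close>, where \<open>c\<close> exceeds \<open>m\<close>.\<close>
  define q where "q t = f \<bullet> t / (m - c \<bullet> t)" for t
  have "Max (q ` T) \<in> q ` T"
    using finite_T f(2) by (intro Max_in) auto
  then obtain w0 where w0: "w0 \<in> T" "q w0 = Max (q ` T)" by auto
  then have max: "q t \<le> q w0" if "t \<in> T" for t
    using that finite_T by simp
  have pos: "0 < m - c \<bullet> t" if "t \<in> S" for t
    using c that by simp
  have TS: "t \<in> S" if "t \<in> T" for t
    using that by (simp add: S_def)
  have "0 < q w"
    using f pos [OF TS] by (simp add: q_def)
  with max [OF f(2)] have q0: "0 < q w0" by simp
  have f0: "f \<bullet> w0 = q w0 * (m - c \<bullet> w0)"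
    using pos [OF TS [OF w0(1)]] by (simp add: q_def)
  have "f \<bullet> s \<le> q w0 * (m - c \<bullet> s)" if "s \<in> S" for s
  proof (cases "s \<in> T")
    case True
    then show ?thesis
      using max [OF True] pos [OF that] by (simp add: q_def pos_divide_le_eq)
  next
    case False
    then have "f \<bullet> s = 0"
      using that f(1) by (auto simp: S_def)
    then show ?thesis using q0 pos [OF that] by simp
  qed
  then have "(f + q w0 *\<^sub>R c) \<bullet> s \<le> (f + q w0 *\<^sub>R c) \<bullet> w0" if "s \<in> S" for s
    using that f0 by (simp add: inner_add_left algebra_simps)
  then have "(f + q w0 *\<^sub>R c) \<bullet> x \<le> (f + q w0 *\<^sub>R c) \<bullet> w0"
    by (rule spanned_max [OF spanned_T [OF w0(1)] _ x(2)])
  then have "f \<bullet> x \<le> q w0 * (m - c \<bullet> x)"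
    using f0 by (simp add: inner_add_left algebra_simps)
  also have "\<dots> < 0"
    using q0 x(1) by (simp add: mult_pos_neg)
  finally show ?thesis .
qed

text \<open>Let \<open>f\<close> be the separating functional without its last coordinate. Unless
  \<open>f\<close> is zero, \<open>separated_imp_neg\<close> applies to both \<open>f\<close> and
  \<open>- f\<close> and yields contradictory signs at \<open>x\<close>. If \<open>f\<close> is
  zero, the functional depends on the height only, and there the apices are extremal.\<close>

lemma P_subset_convex_hull:
  assumes "x \<in> P"
  shows "x \<in> convex hull S"
proof (rule ccontr)
  assume "x \<notin> convex hull S"
  moreover have "closed (convex hull S)"
    by (simp add: compact_imp_closed finite_imp_compact_convex_hull finite_S)
  ultimately obtain a b where ab: "a \<bullet> x < b" "\<forall>y \<in> convex hull S. b < a \<bullet> y"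
    using separating_hyperplane_closed_point convex_convex_hull by metis
  define c where "c = - a"
  define m where "m = - b"
  have x: "m < c \<bullet> x"
    using ab(1) by (simp add: c_def m_def)
  have c: "c \<bullet> s < m" if "s \<in> S" for s
    using ab(2) hull_inc [OF that, of convex] by (simp add: c_def m_def)
  obtain c1 c2 c3 c4 c5 where cV: "c = V c1 c2 c3 c4 c5" by (rule V_cases)
  define sg where "sg t = (if 0 \<le> t then 1 else - 1 :: real)" for t :: real
  have sg: "t * (k * sg t) = k * \<bar>t\<bar>" "\<bar>k * sg t\<bar> = \<bar>k\<bar>" for t k
    by (simp_all add: sg_def)
  define f where "f = V c1 c2 c3 c4 0"
  \<comment> \<open>With signs copied from \<open>c\<close>, the value of \<open>f\<close> at
    \<open>w\<close> is a positive combination of the absolute values of its coefficients and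
    vanishes only for \<open>f = 0\<close>. The point \<open>w'\<close> plays the same part for
    \<open>- f\<close>.\<close>
  define w where "w = V (120 * sg c1) (600 * sg c2) (120 * sg c3) (240 * sg c4) 8100"
  define w' where "w' = V (120 * - sg c1) (600 * - sg c2) (120 * - sg c3) (240 * - sg c4) 8100"
  have w: "w \<in> T" "w' \<in> T"
    by (simp_all add: w_def w'_def V_in_T sg abs_vertices_def)
  have fw: "f \<bullet> w = 120 * \<bar>c1\<bar> + 600 * \<bar>c2\<bar> + 120 * \<bar>c3\<bar> + 240 * \<bar>c4\<bar>"
    by (simp add: f_def w_def sg)
  have fw': "- f \<bullet> w' = f \<bullet> w"
    by (simp add: f_def w_def w'_def)
  show False
  proof (cases "f \<bullet> w = 0")
    case True
    then have "c1 = 0" "c2 = 0" "c3 = 0" "c4 = 0"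
      unfolding fw by linarith+
    then have "c \<bullet> x = c5 * x $ 5"
      by (cases x rule: V_cases) (simp add: cV)
    also have "\<dots> \<le> \<bar>c5\<bar> * \<bar>x $ 5\<bar>"
      using abs_ge_self [of "c5 * x $ 5"] by (simp add: abs_mult)
    also have "\<dots> \<le> \<bar>c5\<bar> * 18900"
      using P_abs_nth_5(1) [OF assms] by (rule mult_left_mono) simp
    also have "\<dots> \<le> m"
      using c [of apex] c [of "- apex"] by (simp add: S_def cV abs_if)
    finally show False using x by simp
  next
    case False
    then have "0 < f \<bullet> w" unfolding fw by linarith
    then have "f \<bullet> x < 0" "- f \<bullet> x < 0"
      using separated_imp_neg [OF c x assms, of f w] separated_imp_neg [OF c x assms, of "- f" w'] w fw'
      by (simp_all add: f_def)
    then show False by simp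
  qed
qed

lemma convex_P: "convex P"
proof -
  have "P = (\<Inter>n \<in> set facet_normals. {x. ivec n \<bullet> x \<le> 18900})"
    by (auto simp: P_def)
  also have "convex \<dots>"
    by (intro convex_INT convex_halfspace_le)
  finally show ?thesis .
qed

lemma P_eq_convex_hull: "P = convex hull S"
  using P_subset_convex_hull hull_minimal [of S P convex] S_subset_P convex_P by blast

lemma polytope_P: "polytope P"
  unfolding polytope_def using P_eq_convex_hull finite_S by blast

lemma extreme_point_of_P_iff: "x extreme_point_of P \<longleftrightarrow> x \<in> S"
  using S_extreme_point extreme_point_of_convex_hull P_eq_convex_hull by metis

section \<open>The length of the spindle\<close>

lemma extreme_point_in_segment:
  assumes "n extreme_point_of A" "n \<in> closed_segment x y" "x \<in> A" "y \<in> A"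
  shows "n = x \<or> n = y"
  using assms unfolding extreme_point_of_def open_segment_def by blast

text \<open>Finitely many strict inequalities survive a small perturbation. The first alternative
  admits the point \<open>w\<close> itself in the later use, where \<open>p\<close> and
  \<open>q\<close> both vanish.\<close>

lemma ex_pos_scale_le:
  fixes p q :: "'a \<Rightarrow> real"
  assumes "finite N" "\<And>n. n \<in> N \<Longrightarrow> p n \<le> 0 \<and> 0 \<le> q n \<or> 0 < q n"
  shows "\<exists>r>0. \<forall>n \<in> N. r * p n \<le> q n"
  using assms
proof (induction N)
  case (insert m N)
  then obtain r where r: "r > 0" "\<forall>n \<in> N. r * p n \<le> q n" by auto
  obtain r' where r': "r' > 0" "r' * p m \<le> q m"
  proof (cases "p m \<le> 0 \<and> 0 \<le> q m")
    case True
    then show ?thesis using that [of 1] by simp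
  next
    case False
    then have "0 < q m" using insert.prems [of m] by auto
    then show ?thesis
      using that [of "q m / (1 + \<bar>p m\<bar>)"] by (simp add: pos_divide_le_eq mult_left_mono)
  qed
  \<comment> \<open>Since \<open>q\<close> is nonnegative, a valid scale may be decreased to any
    smaller positive one.\<close>
  have mono: "min r r' * t \<le> u" if "s * t \<le> u" "0 \<le> u" "min r r' \<le> s" for s t u :: real
  proof (cases "0 \<le> t")
    case True
    then show ?thesis using that(1,3) mult_right_mono [of "min r r'" s t] by linarith
  next
    case False
    then show ?thesis using that(2) r(1) r'(1) by (smt (verit) mult_pos_neg)
  qed
  have "\<forall>n \<in> insert m N. min r r' * p n \<le> q n"
  proof
    fix n assume n: "n \<in> insert m N"
    then have "0 \<le> q n" using insert.prems [of n] by auto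
    then show "min r r' * p n \<le> q n"
      using n r r' mono [of r "p n" "q n"] mono [of r' "p n" "q n"] by auto
  qed
  then show ?case
    using r(1) r'(1) by (intro exI [of _ "min r r'"]) simp
qed (auto intro: exI [of _ 1])

text \<open>If no spanning neighbour of \<^term>\<open>w\<close> lay on the edge, the functional exposing the edge could
  be tilted towards \<^term>\<open>y\<close> without losing its maximum at \<^term>\<open>w\<close>.\<close>

lemma edge_level_diff:
  assumes w: "w \<in> T" and edge: "closed_segment w y edge_of P" and y: "y \<in> S" "y \<noteq> w"
  shows "\<bar>level (w $ 5) - level (y $ 5)\<bar> \<le> 1"
proof (rule ccontr)
  assume far: "\<not> \<bar>level (w $ 5) - level (y $ 5)\<bar> \<le> 1"
  obtain N where N: "N \<subseteq> S" "\<forall>n \<in> N. \<bar>level (w $ 5) - level (n $ 5)\<bar> \<le> 1"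
    "\<forall>c. (\<forall>n \<in> N. c \<bullet> n \<le> c \<bullet> w) \<longrightarrow> (\<forall>x \<in> P. c \<bullet> x \<le> c \<bullet> w)"
    using spanned_T [OF w] unfolding spanned_def by (elim conjE exE) (rule that)
  have "closed_segment w y face_of P"
    using edge by (simp add: edge_of_def)
  then have "closed_segment w y exposed_face_of P"
    using polytope_P exposed_face_of_polyhedron polytope_imp_polyhedron by blast
  then obtain c b where c: "P \<subseteq> {x. c \<bullet> x \<le> b}" "closed_segment w y = P \<inter> {x. c \<bullet> x = b}"
    unfolding exposed_face_of_def by blast
  have cw: "c \<bullet> w = b" "c \<bullet> y = b"
    using c(2) ends_in_segment [of w y] by blast+
  have wP: "w \<in> P" "y \<in> P"
    using w y S_subset_P by (auto simp: S_def)
  \<comment> \<open>\<open>y\<close> is too far in level to belong to \<open>N\<close>, and a vertex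
    on the edge is one of its ends; so every point of \<open>N\<close> other than \<open>w\<close>
    is off the edge.\<close>
  have cn: "n = w \<or> c \<bullet> n < b" if "n \<in> N" for n
  proof -
    have n: "n \<in> S" using that N(1) by blast
    have "n \<noteq> y" using that N(2) far by blast
    then have "n = w \<or> n \<notin> closed_segment w y"
      using extreme_point_in_segment [OF S_extreme_point [OF n]] wP by blast
    moreover have "n \<in> P" using n S_subset_P by blast
    ultimately show ?thesis using c by fastforce
  qed
  have "\<exists>r>0. \<forall>n \<in> N. r * ((y - w) \<bullet> (n - w)) \<le> b - c \<bullet> n"
  proof (rule ex_pos_scale_le)
    show "finite N" using N(1) finite_S by (rule finite_subset)
    show "(y - w) \<bullet> (n - w) \<le> 0 \<and> 0 \<le> b - c \<bullet> n \<or> 0 < b - c \<bullet> n" if "n \<in> N" for n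
      using cn [OF that] cw by auto
  qed
  then obtain r where r: "r > 0" "\<forall>n \<in> N. r * ((y - w) \<bullet> (n - w)) \<le> b - c \<bullet> n"
    by blast
  have "(c + r *\<^sub>R (y - w)) \<bullet> n \<le> (c + r *\<^sub>R (y - w)) \<bullet> w" if "n \<in> N" for n
    using bspec [OF r(2) that] cw by (simp add: inner_add_left inner_diff_right right_diff_distrib)
  \<comment> \<open>At \<open>y\<close> the tilt contributes \<open>r\<close> times the squared
    distance from \<open>w\<close>, so this inequality is absurd.\<close>
  then have "(c + r *\<^sub>R (y - w)) \<bullet> y \<le> (c + r *\<^sub>R (y - w)) \<bullet> w"
    using N(3) wP by blast
  then have "r * ((y - w) \<bullet> (y - w)) \<le> 0"
    using cw by (simp add: inner_add_left inner_diff_right right_diff_distrib)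
  moreover have "0 < r * ((y - w) \<bullet> (y - w))"
    using r(1) y(2) by (intro mult_pos_pos) simp_all
  ultimately show False by linarith
qed

text \<open>The segment between the apices meets the interior of the segment between two vertices
  with opposite first four coordinates; a face would have to contain these as well.\<close>

lemma not_edge_apices: "\<not> closed_segment apex (- apex) edge_of P"
proof
  assume "closed_segment apex (- apex) edge_of P"
  then have face: "closed_segment apex (- apex) face_of P"
    by (simp add: edge_of_def)
  define w where "w = V 120 600 120 240 8100"
  define w' where "w' = V (- 120) (- 600) (- 120) (- 240) 8100"
  have w: "w \<in> T" "w' \<in> T"
    by (simp_all add: w_def w'_def V_in_T abs_vertices_def)
  \<comment> \<open>The weight 2/7 gives height 8100 on the axis: 18900 * (1 - 4/7) = 8100.\<close>
  have "midpoint w w' = (1 - 2 / 7) *\<^sub>R apex + (2 / 7) *\<^sub>R (- apex)"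
    by (simp add: midpoint_def w_def w'_def apex_def)
  then have "midpoint w w' \<in> closed_segment apex (- apex)"
    unfolding in_segment by (intro exI [of _ "2 / 7"]) simp
  moreover have "midpoint w w' \<in> open_segment w w'"
    unfolding midpoint_in_open_segment by (simp add: w_def w'_def)
  ultimately have "w \<in> closed_segment apex (- apex)"
    using face_ofD [OF face] w T_subset_P by blast
  then have "w = apex \<or> w = - apex"
    using w(1) by (intro extreme_point_in_segment [OF S_extreme_point _ apex_in_P]) (simp_all add: S_def)
  then show False
    by (simp add: w_def apex_def)
qed

lemma polytope_graph_level:
  assumes "(x, y) \<in> polytope_graph P"
  shows "\<bar>level (x $ 5) - level (y $ 5)\<bar> \<le> 1"
proof -
  have xy: "x \<in> S" "y \<in> S" "closed_segment x y edge_of P"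
    using assms by (auto simp: polytope_graph_def extreme_point_of_P_iff)
  then have "closed_segment y x edge_of P" by (simp add: closed_segment_commute)
  note yx = this
  show ?thesis
  proof (cases "x = y")
    case False
    then have "x \<in> T \<or> y \<in> T"
      using xy yx not_edge_apices by (auto simp: S_def)
    then show ?thesis
      using edge_level_diff [OF _ xy(3) xy(2)] edge_level_diff [OF _ yx xy(1)] False
      by (metis abs_minus_commute)
  qed simp
qed

lemma walk_level:
  assumes "(x, y) \<in> polytope_graph P ^^ n"
  shows "level (y $ 5) \<le> level (x $ 5) + int n"
  using assms
proof (induction n arbitrary: y)
  case (Suc n)
  then obtain z where "(x, z) \<in> polytope_graph P ^^ n" "(z, y) \<in> polytope_graph P" by auto
  with Suc.IH [of z] polytope_graph_level [of z y] show ?case by simp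
qed simp

text \<open>The segment is shown to be the face on which \<open>V p q r s t\<close> is maximal. In
  the applications this functional is the sum of the normals of facets containing the edge, so
  equality forces each of their slacks to vanish.\<close>

lemma polytope_graph_PI:
  assumes S: "V a1 a2 a3 a4 a5 \<in> S" "V b1 b2 b3 b4 b5 \<in> S"
    and ne: "V a1 a2 a3 a4 a5 \<noteq> V b1 b2 b3 b4 b5"
    and eq: "V p q r s t \<bullet> V b1 b2 b3 b4 b5 = V p q r s t \<bullet> V a1 a2 a3 a4 a5"
    and max: "\<And>x1 x2 x3 x4 x5. V x1 x2 x3 x4 x5 \<in> P \<Longrightarrow>
      V p q r s t \<bullet> V x1 x2 x3 x4 x5 \<le> V p q r s t \<bullet> V a1 a2 a3 a4 a5"
    and segment: "\<And>x1 x2 x3 x4 x5. V x1 x2 x3 x4 x5 \<in> P \<Longrightarrow>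
      V p q r s t \<bullet> V x1 x2 x3 x4 x5 = V p q r s t \<bullet> V a1 a2 a3 a4 a5 \<Longrightarrow>
      \<exists>l. 0 \<le> l \<and> l \<le> 1 \<and> x1 = a1 + l * (b1 - a1) \<and> x2 = a2 + l * (b2 - a2) \<and>
        x3 = a3 + l * (b3 - a3) \<and> x4 = a4 + l * (b4 - a4) \<and> x5 = a5 + l * (b5 - a5)"
  shows "(V a1 a2 a3 a4 a5, V b1 b2 b3 b4 b5) \<in> polytope_graph P"
proof -
  let ?a = "V a1 a2 a3 a4 a5" and ?b = "V b1 b2 b3 b4 b5" and ?c = "V p q r s t"
  have "?c \<bullet> x \<le> ?c \<bullet> ?a" if "x \<in> P" for x
    using max that by (cases x rule: V_cases) (simp del: inner_V)
  then have face: "(P \<inter> {x. ?c \<bullet> x = ?c \<bullet> ?a}) face_of P"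
    by (rule face_of_Int_supporting_hyperplane_le [OF convex_P])
  have "P \<inter> {x. ?c \<bullet> x = ?c \<bullet> ?a} = closed_segment ?a ?b"
  proof
    show "P \<inter> {x. ?c \<bullet> x = ?c \<bullet> ?a} \<subseteq> closed_segment ?a ?b"
    proof
      fix x assume x: "x \<in> P \<inter> {x. ?c \<bullet> x = ?c \<bullet> ?a}"
      obtain x1 x2 x3 x4 x5 where xV: "x = V x1 x2 x3 x4 x5" by (rule V_cases)
      obtain l where "0 \<le> l" "l \<le> 1" "x1 = a1 + l * (b1 - a1)" "x2 = a2 + l * (b2 - a2)"
        "x3 = a3 + l * (b3 - a3)" "x4 = a4 + l * (b4 - a4)" "x5 = a5 + l * (b5 - a5)"
        using segment [of x1 x2 x3 x4 x5] x unfolding xV by blast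
      then show "x \<in> closed_segment ?a ?b"
        unfolding xV closed_segment_def by (auto simp: algebra_simps)
    qed
    have "{?a, ?b} \<subseteq> P \<inter> {x. ?c \<bullet> x = ?c \<bullet> ?a}"
      using S S_subset_P eq by (simp del: inner_V) blast
    then show "closed_segment ?a ?b \<subseteq> P \<inter> {x. ?c \<bullet> x = ?c \<bullet> ?a}"
      unfolding segment_convex_hull by (intro hull_minimal) (use convex_P in \<open>simp_all add: convex_Int convex_hyperplane del: inner_V\<close>)
  qed
  moreover have "aff_dim (closed_segment ?a ?b) = 1"
    using ne by (simp add: segment_convex_hull aff_dim_convex_hull aff_dim_2)
  ultimately show ?thesis
    using face S unfolding polytope_graph_def edge_of_def by (simp add: extreme_point_of_P_iff)
qed

section \<open>Six edges from \<open>apex\<close> to \<open>- apex\<close>, each advancing by one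
  level\<close>

lemma edge_0_0_0_0_120_600_120_240:
  "(V 0 0 0 0 18900, V 120 600 120 240 8100) \<in> polytope_graph P"
proof (rule polytope_graph_PI [where p = "25" and q = "43" and r = "70" and s = "115" and t = "6"])
  fix x1 x2 x3 x4 x5 assume x: "V x1 x2 x3 x4 x5 \<in> P"
  have ineqs:
    "0 \<le> 18900 - 45 * x4 - x5"
    "0 \<le> 18900 - 30 * x3 - 30 * x4 - x5"
    "0 \<le> 18900 - 10 * x2 - 40 * x3 - x5"
    "0 \<le> 18900 - 18 * x2 - x5"
    "0 \<le> 18900 - 10 * x1 - 40 * x4 - x5"
    "0 \<le> 18900 - 15 * x1 - 15 * x2 - x5"
    "0 \<le> 18900 + 18 * x1 - x5"
    "0 \<le> 18900 - 45 * x2 + x5"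
    using facet_ineq [OF x, of 0 0 0 45 1]
      facet_ineq [OF x, of 0 0 30 30 1]
      facet_ineq [OF x, of 0 10 40 0 1]
      facet_ineq [OF x, of 0 18 0 0 1]
      facet_ineq [OF x, of 10 0 0 40 1]
      facet_ineq [OF x, of 15 15 0 0 1]
      facet_ineq [OF x, of "- 18" 0 0 0 1]
      facet_ineq [OF x, of 0 45 0 0 "- 1"]
    by (simp_all add: facet_normals_def)
  show "V 25 43 70 115 6 \<bullet> V x1 x2 x3 x4 x5 \<le> V 25 43 70 115 6 \<bullet> V 0 0 0 0 18900"
    using ineqs by simp
  assume "V 25 43 70 115 6 \<bullet> V x1 x2 x3 x4 x5 = V 25 43 70 115 6 \<bullet> V 0 0 0 0 18900"
  then have "25 * x1 + 43 * x2 + 70 * x3 + 115 * x4 + 6 * x5 = 113400"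
    by simp
  with ineqs have facets: "45 * x4 + x5 = 18900"
    "30 * x3 + 30 * x4 + x5 = 18900"
    "10 * x2 + 40 * x3 + x5 = 18900"
    "18 * x2 + x5 = 18900"
    "10 * x1 + 40 * x4 + x5 = 18900"
    "15 * x1 + 15 * x2 + x5 = 18900"
    by linarith+
  \<comment> \<open>What remains is a line, parametrised by the height \<open>x5\<close>. The last
    two entries of \<open>ineqs\<close> bound \<open>x5\<close> and thereby cut the line at the ends
    of the edge; the other five edges are treated alike.\<close>
  then have eqs: "90 * x1 + x5 = 18900"
    "18 * x2 + x5 = 18900"
    "90 * x3 + x5 = 18900"
    "45 * x4 + x5 = 18900"
    by linarith+
  with ineqs(7,8) have "8100 \<le> x5" "x5 \<le> 18900"
    by linarith+
  with eqs show "\<exists>l. 0 \<le> l \<and> l \<le> 1 \<and> x1 = 0 + l * (120 - 0) \<and> x2 = 0 + l * (600 - 0) \<and> x3 = 0 + l * (120 - 0) \<and> x4 = 0 + l * (240 - 0) \<and> x5 = 18900 + l * (8100 - 18900)"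
    by (intro exI [of _ "(18900 - x5) / 10800"]) (simp add: field_simps)
qed (simp_all add: S_def V_in_T apex_def abs_vertices_def)

lemma edge_120_600_120_240_140_560_140_280:
  "(V 120 600 120 240 8100, V 140 560 140 280 6300) \<in> polytope_graph P"
proof (rule polytope_graph_PI [where p = "10" and q = "45" and r = "30" and s = "115" and t = "2"])
  fix x1 x2 x3 x4 x5 assume x: "V x1 x2 x3 x4 x5 \<in> P"
  have ineqs:
    "0 \<le> 18900 - 45 * x4 - x5"
    "0 \<le> 18900 - 30 * x3 - 30 * x4 - x5"
    "0 \<le> 18900 - 45 * x2 + x5"
    "0 \<le> 18900 - 10 * x1 - 40 * x4 - x5"
    "0 \<le> 18900 - 10 * x2 - 40 * x3 - x5"
    "0 \<le> 18900 - 40 * x2 - 10 * x4 + x5"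
    using facet_ineq [OF x, of 0 0 0 45 1]
      facet_ineq [OF x, of 0 0 30 30 1]
      facet_ineq [OF x, of 0 45 0 0 "- 1"]
      facet_ineq [OF x, of 10 0 0 40 1]
      facet_ineq [OF x, of 0 10 40 0 1]
      facet_ineq [OF x, of 0 40 0 10 "- 1"]
    by (simp_all add: facet_normals_def)
  show "V 10 45 30 115 2 \<bullet> V x1 x2 x3 x4 x5 \<le> V 10 45 30 115 2 \<bullet> V 120 600 120 240 8100"
    using ineqs by simp
  assume "V 10 45 30 115 2 \<bullet> V x1 x2 x3 x4 x5 = V 10 45 30 115 2 \<bullet> V 120 600 120 240 8100"
  then have "10 * x1 + 45 * x2 + 30 * x3 + 115 * x4 + 2 * x5 = 75600"
    by simp
  with ineqs have facets: "45 * x4 + x5 = 18900"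
    "30 * x3 + 30 * x4 + x5 = 18900"
    "45 * x2 - x5 = 18900"
    "10 * x1 + 40 * x4 + x5 = 18900"
    by linarith+
  then have eqs: "90 * x1 + x5 = 18900"
    "45 * x2 - x5 = 18900"
    "90 * x3 + x5 = 18900"
    "45 * x4 + x5 = 18900"
    by linarith+
  with ineqs(5,6) have "6300 \<le> x5" "x5 \<le> 8100"
    by linarith+
  with eqs show "\<exists>l. 0 \<le> l \<and> l \<le> 1 \<and> x1 = 120 + l * (140 - 120) \<and> x2 = 600 + l * (560 - 600) \<and> x3 = 120 + l * (140 - 120) \<and> x4 = 240 + l * (280 - 240) \<and> x5 = 8100 + l * (6300 - 8100)"
    by (intro exI [of _ "(8100 - x5) / 1800"]) (simp add: field_simps)
qed (simp_all add: S_def V_in_T apex_def abs_vertices_def)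

lemma edge_140_560_140_280_252_252_252_504:
  "(V 140 560 140 280 6300, V 252 252 252 504 (- 3780)) \<in> polytope_graph P"
proof (rule polytope_graph_PI [where p = "10" and q = "40" and r = "30" and s = "125" and t = "2"])
  fix x1 x2 x3 x4 x5 assume x: "V x1 x2 x3 x4 x5 \<in> P"
  have ineqs:
    "0 \<le> 18900 - 45 * x4 - x5"
    "0 \<le> 18900 - 30 * x3 - 30 * x4 - x5"
    "0 \<le> 18900 - 40 * x2 - 10 * x4 + x5"
    "0 \<le> 18900 - 10 * x1 - 40 * x4 - x5"
    "0 \<le> 18900 - 45 * x2 + x5"
    "0 \<le> 18900 - 30 * x1 - 30 * x2 + x5"
    using facet_ineq [OF x, of 0 0 0 45 1]
      facet_ineq [OF x, of 0 0 30 30 1]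
      facet_ineq [OF x, of 0 40 0 10 "- 1"]
      facet_ineq [OF x, of 10 0 0 40 1]
      facet_ineq [OF x, of 0 45 0 0 "- 1"]
      facet_ineq [OF x, of 30 30 0 0 "- 1"]
    by (simp_all add: facet_normals_def)
  show "V 10 40 30 125 2 \<bullet> V x1 x2 x3 x4 x5 \<le> V 10 40 30 125 2 \<bullet> V 140 560 140 280 6300"
    using ineqs by simp
  assume "V 10 40 30 125 2 \<bullet> V x1 x2 x3 x4 x5 = V 10 40 30 125 2 \<bullet> V 140 560 140 280 6300"
  then have "10 * x1 + 40 * x2 + 30 * x3 + 125 * x4 + 2 * x5 = 75600"
    by simp
  with ineqs have facets: "45 * x4 + x5 = 18900"
    "30 * x3 + 30 * x4 + x5 = 18900"
    "40 * x2 + 10 * x4 - x5 = 18900"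
    "10 * x1 + 40 * x4 + x5 = 18900"
    by linarith+
  then have eqs: "90 * x1 + x5 = 18900"
    "360 * x2 - 11 * x5 = 132300"
    "90 * x3 + x5 = 18900"
    "45 * x4 + x5 = 18900"
    by linarith+
  with ineqs(5,6) have "- 3780 \<le> x5" "x5 \<le> 6300"
    by linarith+
  with eqs show "\<exists>l. 0 \<le> l \<and> l \<le> 1 \<and> x1 = 140 + l * (252 - 140) \<and> x2 = 560 + l * (252 - 560) \<and> x3 = 140 + l * (252 - 140) \<and> x4 = 280 + l * (504 - 280) \<and> x5 = 6300 + l * (- 3780 - 6300)"
    by (intro exI [of _ "(6300 - x5) / 10080"]) (simp add: field_simps)
qed (simp_all add: S_def V_in_T apex_def abs_vertices_def)

lemma edge_252_252_252_504_245_175_280_560: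
  "(V 252 252 252 504 (- 3780), V 245 175 280 560 (- 6300)) \<in> polytope_graph P"
proof (rule polytope_graph_PI [where p = "30" and q = "70" and r = "30" and s = "85" and t = "0"])
  fix x1 x2 x3 x4 x5 assume x: "V x1 x2 x3 x4 x5 \<in> P"
  have ineqs:
    "0 \<le> 18900 - 45 * x4 - x5"
    "0 \<le> 18900 - 30 * x3 - 30 * x4 - x5"
    "0 \<le> 18900 - 40 * x2 - 10 * x4 + x5"
    "0 \<le> 18900 - 30 * x1 - 30 * x2 + x5"
    "0 \<le> 18900 - 10 * x1 - 40 * x4 - x5"
    "0 \<le> 18900 - 15 * x3 - 15 * x4 + x5"
    using facet_ineq [OF x, of 0 0 0 45 1]
      facet_ineq [OF x, of 0 0 30 30 1]
      facet_ineq [OF x, of 0 40 0 10 "- 1"]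
      facet_ineq [OF x, of 30 30 0 0 "- 1"]
      facet_ineq [OF x, of 10 0 0 40 1]
      facet_ineq [OF x, of 0 0 15 15 "- 1"]
    by (simp_all add: facet_normals_def)
  show "V 30 70 30 85 0 \<bullet> V x1 x2 x3 x4 x5 \<le> V 30 70 30 85 0 \<bullet> V 252 252 252 504 (- 3780)"
    using ineqs by simp
  assume "V 30 70 30 85 0 \<bullet> V x1 x2 x3 x4 x5 = V 30 70 30 85 0 \<bullet> V 252 252 252 504 (- 3780)"
  then have "30 * x1 + 70 * x2 + 30 * x3 + 85 * x4 = 75600"
    by simp
  with ineqs have facets: "45 * x4 + x5 = 18900"
    "30 * x3 + 30 * x4 + x5 = 18900"
    "40 * x2 + 10 * x4 - x5 = 18900"
    "30 * x1 + 30 * x2 - x5 = 18900"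
    by linarith+
  then have eqs: "360 * x1 - x5 = 94500"
    "360 * x2 - 11 * x5 = 132300"
    "90 * x3 + x5 = 18900"
    "45 * x4 + x5 = 18900"
    by linarith+
  with ineqs(5,6) have "- 6300 \<le> x5" "x5 \<le> - 3780"
    by linarith+
  with eqs show "\<exists>l. 0 \<le> l \<and> l \<le> 1 \<and> x1 = 252 + l * (245 - 252) \<and> x2 = 252 + l * (175 - 252) \<and> x3 = 252 + l * (280 - 252) \<and> x4 = 504 + l * (560 - 504) \<and> x5 = - 3780 + l * (- 6300 - (- 3780))"
    by (intro exI [of _ "(- 3780 - x5) / 2520"]) (simp add: field_simps)
qed (simp_all add: S_def V_in_T apex_def abs_vertices_def)

lemma edge_245_175_280_560_240_120_120_600:
  "(V 245 175 280 560 (- 6300), V 240 120 120 600 (- 8100)) \<in> polytope_graph P"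
proof (rule polytope_graph_PI [where p = "70" and q = "70" and r = "25" and s = "70" and t = "- 3"])
  fix x1 x2 x3 x4 x5 assume x: "V x1 x2 x3 x4 x5 \<in> P"
  have ineqs:
    "0 \<le> 18900 - 45 * x4 - x5"
    "0 \<le> 18900 - 15 * x3 - 15 * x4 + x5"
    "0 \<le> 18900 - 40 * x2 - 10 * x4 + x5"
    "0 \<le> 18900 - 30 * x1 - 30 * x2 + x5"
    "0 \<le> 18900 - 40 * x1 - 10 * x3 + x5"
    "0 \<le> 18900 - 30 * x3 - 30 * x4 - x5"
    "0 \<le> 18900 - 18 * x4 + x5"
    using facet_ineq [OF x, of 0 0 0 45 1]
      facet_ineq [OF x, of 0 0 15 15 "- 1"]
      facet_ineq [OF x, of 0 40 0 10 "- 1"]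
      facet_ineq [OF x, of 30 30 0 0 "- 1"]
      facet_ineq [OF x, of 40 0 10 0 "- 1"]
      facet_ineq [OF x, of 0 0 30 30 1]
      facet_ineq [OF x, of 0 0 0 18 "- 1"]
    by (simp_all add: facet_normals_def)
  show "V 70 70 25 70 (- 3) \<bullet> V x1 x2 x3 x4 x5 \<le> V 70 70 25 70 (- 3) \<bullet> V 245 175 280 560 (- 6300)"
    using ineqs by simp
  assume "V 70 70 25 70 (- 3) \<bullet> V x1 x2 x3 x4 x5 = V 70 70 25 70 (- 3) \<bullet> V 245 175 280 560 (- 6300)"
  then have "70 * x1 + 70 * x2 + 25 * x3 + 70 * x4 - 3 * x5 = 94500"
    by simp
  with ineqs have facets: "45 * x4 + x5 = 18900"
    "15 * x3 + 15 * x4 - x5 = 18900"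
    "40 * x2 + 10 * x4 - x5 = 18900"
    "30 * x1 + 30 * x2 - x5 = 18900"
    "40 * x1 + 10 * x3 - x5 = 18900"
    by linarith+
  then have eqs: "360 * x1 - x5 = 94500"
    "360 * x2 - 11 * x5 = 132300"
    "45 * x3 - 4 * x5 = 37800"
    "45 * x4 + x5 = 18900"
    by linarith+
  with ineqs(6,7) have "- 8100 \<le> x5" "x5 \<le> - 6300"
    by linarith+
  with eqs show "\<exists>l. 0 \<le> l \<and> l \<le> 1 \<and> x1 = 245 + l * (240 - 245) \<and> x2 = 175 + l * (120 - 175) \<and> x3 = 280 + l * (120 - 280) \<and> x4 = 560 + l * (600 - 560) \<and> x5 = - 6300 + l * (- 8100 - (- 6300))"
    by (intro exI [of _ "(- 6300 - x5) / 1800"]) (simp add: field_simps)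
qed (simp_all add: S_def V_in_T apex_def abs_vertices_def)

lemma edge_240_120_120_600_0_0_0_0:
  "(V 240 120 120 600 (- 8100), V 0 0 0 0 (- 18900)) \<in> polytope_graph P"
proof (rule polytope_graph_PI [where p = "115" and q = "70" and r = "25" and s = "43" and t = "- 6"])
  fix x1 x2 x3 x4 x5 assume x: "V x1 x2 x3 x4 x5 \<in> P"
  have ineqs:
    "0 \<le> 18900 - 18 * x4 + x5"
    "0 \<le> 18900 - 15 * x3 - 15 * x4 + x5"
    "0 \<le> 18900 - 40 * x2 - 10 * x4 + x5"
    "0 \<le> 18900 - 30 * x1 - 30 * x2 + x5"
    "0 \<le> 18900 - 40 * x1 - 10 * x3 + x5"
    "0 \<le> 18900 - 45 * x1 + x5"
    "0 \<le> 18900 - 45 * x4 - x5"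
    "0 \<le> 18900 + 45 * x1 + x5"
    using facet_ineq [OF x, of 0 0 0 18 "- 1"]
      facet_ineq [OF x, of 0 0 15 15 "- 1"]
      facet_ineq [OF x, of 0 40 0 10 "- 1"]
      facet_ineq [OF x, of 30 30 0 0 "- 1"]
      facet_ineq [OF x, of 40 0 10 0 "- 1"]
      facet_ineq [OF x, of 45 0 0 0 "- 1"]
      facet_ineq [OF x, of 0 0 0 45 1]
      facet_ineq [OF x, of "- 45" 0 0 0 "- 1"]
    by (simp_all add: facet_normals_def)
  show "V 115 70 25 43 (- 6) \<bullet> V x1 x2 x3 x4 x5 \<le> V 115 70 25 43 (- 6) \<bullet> V 240 120 120 600 (- 8100)"
    using ineqs by simp
  assume "V 115 70 25 43 (- 6) \<bullet> V x1 x2 x3 x4 x5 = V 115 70 25 43 (- 6) \<bullet> V 240 120 120 600 (- 8100)"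
  then have "115 * x1 + 70 * x2 + 25 * x3 + 43 * x4 - 6 * x5 = 113400"
    by simp
  with ineqs have facets: "18 * x4 - x5 = 18900"
    "15 * x3 + 15 * x4 - x5 = 18900"
    "40 * x2 + 10 * x4 - x5 = 18900"
    "30 * x1 + 30 * x2 - x5 = 18900"
    "40 * x1 + 10 * x3 - x5 = 18900"
    "45 * x1 - x5 = 18900"
    by linarith+
  then have eqs: "45 * x1 - x5 = 18900"
    "90 * x2 - x5 = 18900"
    "90 * x3 - x5 = 18900"
    "18 * x4 - x5 = 18900"
    by linarith+
  with ineqs(7,8) have "- 18900 \<le> x5" "x5 \<le> - 8100"
    by linarith+
  with eqs show "\<exists>l. 0 \<le> l \<and> l \<le> 1 \<and> x1 = 240 + l * (0 - 240) \<and> x2 = 120 + l * (0 - 120) \<and> x3 = 120 + l * (0 - 120) \<and> x4 = 600 + l * (0 - 600) \<and> x5 = - 8100 + l * (- 18900 - (- 8100))"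
    by (intro exI [of _ "(- 8100 - x5) / 10800"]) (simp add: field_simps)
qed (simp_all add: S_def V_in_T apex_def abs_vertices_def)

lemma walk_apices: "(apex, - apex) \<in> polytope_graph P ^^ 6"
proof -
  have "(V 0 0 0 0 18900, V 0 0 0 0 (- 18900)) \<in> polytope_graph P ^^ Suc (Suc (Suc (Suc (Suc (Suc 0)))))"
    by (rule relpow_Suc_I2 [OF edge_0_0_0_0_120_600_120_240
      relpow_Suc_I2 [OF edge_120_600_120_240_140_560_140_280
      relpow_Suc_I2 [OF edge_140_560_140_280_252_252_252_504
      relpow_Suc_I2 [OF edge_252_252_252_504_245_175_280_560
      relpow_Suc_I2 [OF edge_245_175_280_560_240_120_120_600
      relpow_Suc_I2 [OF edge_240_120_120_600_0_0_0_0 relpow_0_I]]]]]])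
  then show ?thesis by (simp add: apex_def eval_nat_numeral)
qed

lemma spindle_length_P: "spindle_length P apex (- apex) = 6"
proof -
  have "6 \<le> n" if "(apex, - apex) \<in> polytope_graph P ^^ n" for n
    using walk_level [OF that] by simp
  then have "(INF n \<in> {n. (apex, - apex) \<in> polytope_graph P ^^ n}. enat n) = enat 6"
    using walk_apices by (intro antisym INF_lower INF_greatest) auto
  then show ?thesis
    by (simp add: spindle_length_def graph_dist_def numeral_eq_enat)
qed

section \<open>The facets\<close>

text \<open>An integer copy of the inner product, so that products of normals and test points can be
  evaluated.\<close>

fun idot :: "int \<times> int \<times> int \<times> int \<times> int \<Rightarrow> int \<times> int \<times> int \<times> int \<times> int \<Rightarrow> int" where
  "idot (a, b, c, d, e) (a', b', c', d', e') = a * a' + b * b' + c * c' + d * d' + e * e'"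

lemma inner_ivec: "ivec m \<bullet> ivec n = of_int (idot m n)"
  by (cases m; cases n) simp

text \<open>300 times this point lies in the relative interior of the facet with the given normal, and
  301 times it violates no other facet inequality; note that 63 is 18900 divided by 300.\<close>

fun facet_point :: "int \<times> int \<times> int \<times> int \<times> int \<Rightarrow> int \<times> int \<times> int \<times> int \<times> int" where
  "facet_point (a, b, c, d, e) =
    (sgn a, sgn b, sgn c, sgn d, e * (63 - (\<bar>a\<bar> + \<bar>b\<bar> + \<bar>c\<bar> + \<bar>d\<bar>)))"

text \<open>As \<open>e\<close> is 1 or -1, the last coordinate of \<open>facet_point m\<close>
  makes its product with \<open>m\<close> equal to 63. The gap to 62 leaves room for the factor 301,
  since 301 * 62 = 18662 < 18900 < 18963 = 301 * 63.\<close>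

lemma facet_normals_check:
  "distinct facet_normals \<and> length facet_normals = 48 \<and>
   list_all (\<lambda>m. list_all (\<lambda>n. if m = n then idot n (facet_point m) = 63
     else idot n (facet_point m) \<le> 62) facet_normals) facet_normals"
  by code_simp

lemma card_facet_normals: "card (set facet_normals) = 48"
  using facet_normals_check by (simp add: distinct_card)

lemma inner_facet_point:
  assumes "m \<in> set facet_normals" "n \<in> set facet_normals"
  shows "m = n \<Longrightarrow> ivec n \<bullet> ivec (facet_point m) = 63"
    "m \<noteq> n \<Longrightarrow> ivec n \<bullet> ivec (facet_point m) \<le> 62"
  using facet_normals_check assms by (auto simp: list_all_iff inner_ivec)

definition facet :: "int \<times> int \<times> int \<times> int \<times> int \<Rightarrow> (real ^ 5) set" where
  "facet n = P \<inter> {x. ivec n \<bullet> x = 18900}"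

lemma inj_on_facet: "inj_on facet (set facet_normals)"
proof (rule inj_onI, rule ccontr)
  fix m n assume mn: "m \<in> set facet_normals" "n \<in> set facet_normals" "facet m = facet n" "m \<noteq> n"
  \<comment> \<open>This point of \<open>P\<close> is tight for the normal \<open>m\<close> and for
    no other.\<close>
  let ?x = "300 *\<^sub>R ivec (facet_point m)"
  have "ivec k \<bullet> ?x \<le> 18900" if "k \<in> set facet_normals" for k
    using inner_facet_point [OF mn(1) that] by (cases "m = k") auto
  moreover have "ivec m \<bullet> ?x = 18900"
    using inner_facet_point(1) [OF mn(1,1)] by simp
  ultimately have "?x \<in> facet m"
    by (simp add: facet_def P_def)
  moreover have "?x \<notin> facet n"
    using inner_facet_point(2) [OF mn(1,2,4)] by (simp add: facet_def)
  ultimately show False using mn(3) by simp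
qed

text \<open>The origin satisfies all inequalities strictly. This provides both the dimension and the
  affine hull of \<open>P\<close>.\<close>

lemma interior_P_nonempty: "interior P \<noteq> {}"
proof -
  let ?U = "\<Inter>n \<in> set facet_normals. {x. ivec n \<bullet> x < 18900}"
  have "open ?U"
    by (intro open_INT ballI open_halfspace_lt) simp
  moreover have "0 \<in> ?U" by simp
  moreover have "?U \<subseteq> P"
    unfolding P_def by (blast intro: less_imp_le)
  ultimately have "0 \<in> interior P" by (rule interiorI)
  then show ?thesis by blast
qed

text \<open>For an irredundant system of halfspaces the facets are exactly the tight sets.
  Irredundancy is witnessed by \<open>301 *\<^sub>R ivec (facet_point m)\<close>, which violates the
  inequality of \<open>m\<close> alone.\<close>

lemma facet_of_P_iff: "C facet_of P \<longleftrightarrow> (\<exists>n \<in> set facet_normals. C = facet n)"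
proof -
  define H where "H n = {x. ivec n \<bullet> x \<le> 18900}" for n
  \<comment> \<open>\<open>facet_of_polyhedron_explicit\<close> indexes normals by halfspaces, so
    each normal must be recovered from its halfspace; \<open>over\<close> shows that distinct
    normals give distinct halfspaces.\<close>
  define normal where "normal = inv_into (set facet_normals) H"
  have over: "301 *\<^sub>R ivec (facet_point m) \<in> H n \<longleftrightarrow> m \<noteq> n"
    if "m \<in> set facet_normals" "n \<in> set facet_normals" for m n
    using inner_facet_point [OF that] by (cases "m = n") (auto simp: H_def)
  then have "inj_on H (set facet_normals)"
    by (metis inj_onI)
  then have normal: "normal (H n) = n" if "n \<in> set facet_normals" for n
    using that by (simp add: normal_def)
  have aff: "affine hull P = UNIV"
    using affine_hull_nonempty_interior interior_P_nonempty by blast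
  have "C facet_of P \<longleftrightarrow>
      (\<exists>h. h \<in> H ` set facet_normals \<and> C = P \<inter> {x. ivec (normal h) \<bullet> x = 18900})"
  proof (rule facet_of_polyhedron_explicit)
    show "finite (H ` set facet_normals)" by simp
    show P: "P = affine hull P \<inter> \<Inter> (H ` set facet_normals)"
      unfolding aff by (auto simp: P_def H_def)
    show "ivec (normal h) \<noteq> 0 \<and> h = {x. ivec (normal h) \<bullet> x \<le> 18900}"
      if h: "h \<in> H ` set facet_normals" for h
    proof -
      obtain n where n: "n \<in> set facet_normals" "h = H n" using h by blast
      have "ivec n \<noteq> 0"
        using inner_facet_point(1) [OF n(1,1)] by auto
      then show ?thesis
        using normal [OF n(1)] n(2) by (simp add: H_def)
    qed
    show "P \<subset> affine hull P \<inter> \<Inter> F'" if F': "F' \<subset> H ` set facet_normals" for F'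
    proof -
      obtain m where m: "m \<in> set facet_normals" "H m \<notin> F'"
        using F' by blast
      have "301 *\<^sub>R ivec (facet_point m) \<in> \<Inter> F'"
      proof
        fix h assume "h \<in> F'"
        then obtain n where "n \<in> set facet_normals" "h = H n" using F' by blast
        with over [OF m(1)] m(2) \<open>h \<in> F'\<close> show "301 *\<^sub>R ivec (facet_point m) \<in> h" by blast
      qed
      moreover have "301 *\<^sub>R ivec (facet_point m) \<notin> P"
        using over [OF m(1,1)] m(1) by (auto simp: P_def H_def)
      moreover have "P \<subseteq> \<Inter> F'"
        using P F' by blast
      ultimately show ?thesis
        unfolding aff by blast
    qed
  qed
  then show ?thesis
    using normal by (auto simp: facet_def)
qed

lemma card_facets_P: "card {F. F facet_of P} = 48"
proof -
  have "{F. F facet_of P} = facet ` set facet_normals"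
    using facet_of_P_iff by blast
  then show ?thesis
    using card_image [OF inj_on_facet] card_facet_normals by simp
qed

text \<open>The last entry of a normal is 1 or -1, so its inequality is tight at exactly one
  apex.\<close>

lemma apex_in_facet:
  assumes "n \<in> set facet_normals"
  shows "apex \<in> facet n \<longleftrightarrow> - apex \<notin> facet n"
proof -
  have "list_all (\<lambda>(a, b, c, d, e). e = 1 \<or> e = - 1) facet_normals"
    by (simp add: facet_normals_def)
  moreover obtain a b c d e where "n = (a, b, c, d, e)" by (rule prod_cases5)
  ultimately show ?thesis
    using assms apex_in_P by (auto simp: list_all_iff facet_def apex_def)
qed

lemma spindle_P: "spindle 5 P apex (- apex)"
proof -
  have "aff_dim P = 5"
    using interior_P_nonempty by (simp add: aff_dim_nonempty_interior)
  moreover have "apex \<noteq> - apex"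
    by (simp add: apex_def)
  moreover have "apex extreme_point_of P" "- apex extreme_point_of P"
    by (simp_all add: extreme_point_of_P_iff S_def)
  ultimately show ?thesis
    unfolding spindle_def using polytope_P facet_of_P_iff apex_in_facet by auto
qed

theorem theorem1p6:
  "\<exists>(P :: (real ^ 5) set) u v.
     spindle 5 P u v \<and>
     card {F. F facet_of P} = 48 \<and>
     card {x. x extreme_point_of P} = 322 \<and>
     spindle_length P u v = 6"
  using spindle_P card_facets_P spindle_length_P card_S
  by (intro exI [of _ P] exI [of _ apex] exI [of _ "- apex"]) (simp add: extreme_point_of_P_iff)

end
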